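(* Let $D$ be a weakly locally finite division ring and $n$ a positive integer. Then every periodic subgroup of $\mathrm{GL}_n(D)$ is a locally finite group.
   Context: A division ring is centrally finite if it is finite-dimensional over its center. A division ring $D$ is weakly locally finite if for every finite subset $S$ of $D$ the division subring of $D$ generated by $S$ is centrally finite. $\mathrm{GL}_n(D)$ is the group of invertible $n\times n$ matrices over $D$. A group is periodic if each of its elements has finite order, and locally finite if all its finitely generated subgroups are finite. *)

theory Defs
  imports
    "HOL-Algebra.Embedded_Algebras"
    "HOL-Algebra.Algebraic_Closure_Type"
    "Jordan_Normal_Form.Matrix"
begin

(* Closure under inverse needs no exception for 0, since inverse 0 = 0. *)
definition division_subring :: "'a::division_ring set \<Rightarrow> bool" where
  "division_subring K \<longleftrightarrow>
     1 \<in> K \<and> (\<forall>x\<in>K. \<forall>y\<in>K. x - y \<in> K \<and> x * y \<in> K) \<and> (\<forall>x\<in>K. inverse x \<in> K)"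

definition division_subring_generated :: "'a::division_ring set \<Rightarrow> 'a set" where
  "division_subring_generated S = \<Inter>{K. division_subring K \<and> S \<subseteq> K}"

definition ring_center :: "'a::ring_1 set \<Rightarrow> 'a set" where
  "ring_center K = {z \<in> K. \<forall>x\<in>K. z * x = x * z}"

(* K is a division subring of the type 'a.  The scalars are its own centre, not the centre
   of 'a.  The ambient ring only supplies the operations. *)
definition centrally_finite :: "'a::division_ring set \<Rightarrow> bool" where
  "centrally_finite K \<longleftrightarrow> ring.finite_dimension ring_of_type_algebra (ring_center K) K"

definition weakly_locally_finite :: "'a::division_ring itself \<Rightarrow> bool" where
  "weakly_locally_finite _ \<longleftrightarrow>
     (\<forall>S :: 'a set. finite S \<longrightarrow> centrally_finite (division_subring_generated S))"

definition GL :: "nat \<Rightarrow> 'a::division_ring itself \<Rightarrow> 'a mat monoid" where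
  "GL n ty = units_of (ring_mat ty n ())"

definition periodic_group :: "('a, 'b) monoid_scheme \<Rightarrow> bool" where
  "periodic_group G \<longleftrightarrow> (\<forall>x\<in>carrier G. \<exists>k::nat. k > 0 \<and> x [^]\<^bsub>G\<^esub> k = \<one>\<^bsub>G\<^esub>)"

definition locally_finite_group :: "('a, 'b) monoid_scheme \<Rightarrow> bool" where
  "locally_finite_group G \<longleftrightarrow> (\<forall>S\<subseteq>carrier G. finite S \<longrightarrow> finite (generate G S))"

lemma group_GL: "group (GL n TYPE('a::division_ring))"
  unfolding GL_def
  by (intro monoid.units_group semiring.axioms(2) semiring_mat)

lemma division_subring_generated:
  "division_subring (division_subring_generated S)" "S \<subseteq> division_subring_generated S"
  unfolding division_subring_generated_def division_subring_def by auto

lemma ring_ring_of_type_algebra: "ring (ring_of_type_algebra :: 'a::ring_1 ring)"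
proof -
  have "\<exists>y. x + y = 0" for x :: 'a
    using add.right_inverse by blast
  thus ?thesis
    unfolding ring_of_type_algebra_def
    by unfold_locales (auto simp: algebra_simps Units_def)
qed

lemma subfield_ring_center:
  fixes K :: "'a::division_ring set"
  assumes "division_subring K"
  shows "subfield (ring_center K) (ring_of_type_algebra :: 'a ring)"
proof -
  let ?R = "ring_of_type_algebra :: 'a ring"
  interpret ring ?R by (rule ring_ring_of_type_algebra)
  note sel = ring_of_type_algebra_def
  have K: "1 \<in> K" "\<And>x y. x \<in> K \<Longrightarrow> y \<in> K \<Longrightarrow> x - y \<in> K"
    "\<And>x y. x \<in> K \<Longrightarrow> y \<in> K \<Longrightarrow> x * y \<in> K" "\<And>x. x \<in> K \<Longrightarrow> inverse x \<in> K"
    using assms by (auto simp: division_subring_def)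
  have K0: "0 \<in> K" using K(2)[OF K(1) K(1)] by simp
  have Km: "- x \<in> K" if "x \<in> K" for x using K(2)[OF K0 that] by simp
  have Kp: "x + y \<in> K" if "x \<in> K" "y \<in> K" for x y using K(2)[OF that(1) Km[OF that(2)]] by simp
  have minus: "\<ominus>\<^bsub>?R\<^esub> x = - x" for x
    by (rule minus_equality) (auto simp: sel)
  have in_K: "z \<in> K" if "z \<in> ring_center K" for z
    using that unfolding ring_center_def by blast
  have comm: "z * x = x * z" if "z \<in> ring_center K" "x \<in> K" for z x
    using that unfolding ring_center_def by blast
  have centerI: "z \<in> ring_center K" if "z \<in> K" "\<And>x. x \<in> K \<Longrightarrow> z * x = x * z" for z
    using that unfolding ring_center_def by blast
  have "subcring (ring_center K) ?R"
  proof (intro subcringI subringI)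
    show "ring_center K \<subseteq> carrier ?R" by (simp add: sel)
    show "\<one>\<^bsub>?R\<^esub> \<in> ring_center K" using K(1) by (simp add: sel centerI)
    show "\<ominus>\<^bsub>?R\<^esub> h \<in> ring_center K" if h: "h \<in> ring_center K" for h
      unfolding minus by (rule centerI[OF Km[OF in_K[OF h]]]) (simp add: comm[OF h])
    show "h \<otimes>\<^bsub>?R\<^esub> h' = h' \<otimes>\<^bsub>?R\<^esub> h" if "h \<in> ring_center K" "h' \<in> ring_center K" for h h'
      using comm[OF that(1) in_K[OF that(2)]] unfolding sel by simp
    fix h h' assume h: "h \<in> ring_center K" "h' \<in> ring_center K"
    have "h * h' \<in> ring_center K"
    proof (rule centerI[OF K(3)[OF in_K[OF h(1)] in_K[OF h(2)]]])
      fix x assume x: "x \<in> K"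
      have "h * h' * x = h * (x * h')" by (simp only: mult.assoc comm[OF h(2) x])
      also have "\<dots> = x * h * h'" by (simp only: mult.assoc[symmetric] comm[OF h(1) x])
      finally show "h * h' * x = x * (h * h')" by (simp only: mult.assoc)
    qed
    then show "h \<otimes>\<^bsub>?R\<^esub> h' \<in> ring_center K" by (simp add: sel)
    have "h + h' \<in> ring_center K"
      by (rule centerI[OF Kp[OF in_K[OF h(1)] in_K[OF h(2)]]]) (simp only: distrib_left distrib_right comm[OF h(1)] comm[OF h(2)])
    then show "h \<oplus>\<^bsub>?R\<^esub> h' \<in> ring_center K" by (simp add: sel)
  qed
  moreover have inv: "inverse x \<in> ring_center K" if x: "x \<in> ring_center K" "x \<noteq> 0" for x
  proof (rule centerI[OF K(4)[OF in_K[OF x(1)]]])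
    fix y assume y: "y \<in> K"
    have "inverse x * y = inverse x * (y * x) * inverse x"
      using x(2) by (simp add: mult.assoc)
    also have "\<dots> = inverse x * (x * y) * inverse x"
      by (simp only: comm[OF x(1) y])
    also have "\<dots> = y * inverse x"
      using x(2) by (simp flip: mult.assoc)
    finally show "inverse x * y = y * inverse x" .
  qed
  have "Units (?R\<lparr>carrier := ring_center K\<rparr>) = ring_center K - {\<zero>\<^bsub>?R\<^esub>}"
  proof (intro equalityI subsetI)
    fix x assume "x \<in> Units (?R\<lparr>carrier := ring_center K\<rparr>)"
    then show "x \<in> ring_center K - {\<zero>\<^bsub>?R\<^esub>}" by (auto simp: sel Units_def)
  next
    fix x assume "x \<in> ring_center K - {\<zero>\<^bsub>?R\<^esub>}"
    then have x: "x \<in> ring_center K" "x \<noteq> 0" by (simp_all add: sel)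
    then have "x * inverse x = 1" "inverse x * x = 1" by simp_all
    with x(1) inv[OF x] show "x \<in> Units (?R\<lparr>carrier := ring_center K\<rparr>)"
      by (auto simp: sel Units_def intro: bexI[of _ "inverse x"])
  qed
  ultimately show ?thesis
    by (rule subfieldI)
qed

end

theory Submission
  imports Defs "HOL-Library.List_Lenlexorder" "HOL-Library.Infinite_Set" "HOL-Combinatorics.Permutations"
begin

text \<open>
  A finitely generated subgroup of \<open>H\<close> has entries in a division ring \<open>K\<close> of finite dimension over its
  centre, so the matrices over \<open>K\<close> satisfy a standard polynomial identity. By Shirshov's theorem on
  words, the ring generated by the group is then spanned, as an abelian group, by finitely many words:
  long words either contain a high power of a word, which shortens because the group is periodic, or
  can be rewritten by the identity as an integer combination of lexicographically smaller words.
  In positive characteristic this ring is finite. In characteristic 0 it has no torsion, and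
  Minkowski's argument shows that the group embeds into the finite quotient ring modulo 3.
\<close>

section \<open>Unavoidable regularities of words\<close>

text \<open>Linear algebra over the centre of \<open>K\<close> only shows that the group spans a
  finite-dimensional space, and the centre may be infinite, so no finiteness follows. The span over
  the integers is the right object, and its finite generation is the difficulty. The standard
  polynomial suits this because its coefficients are signs: the monomial of the identity permutation
  can be isolated without division. The modulus 3 is the smallest possible in general, since
  \<open>-1\<close> is congruent to 1 modulo 2 and has finite order. No quotient ring is formed:
  elements are labelled by residues of their coefficients, and labels are counted. Matrices of one
  size do not make up a type, so they are realised in a ring of additive maps on sequences, where
  integer spans and products are available through type classes.\<close>

text \<open>Koenig's lemma: \<open>E\<close> keeps to prefixes with infinitely many continuations in
  \<open>P\<close>, and with finitely many letters some one-letter extension inherits this.\<close>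

lemma prefix_closed_infinite_branch:
  fixes P :: "'a list set"
  assumes A: "finite A" "P \<subseteq> lists A" and inf: "infinite P"
    and prefix: "\<And>u v. u @ v \<in> P \<Longrightarrow> u \<in> P"
  shows "\<exists>w. \<forall>n. map w [0..<n] \<in> P"
proof -
  define E where "E v = infinite {u. v @ u \<in> P}" for v
  have step: "\<exists>a. E (v @ [a])" if "E v" for v
  proof (rule ccontr)
    assume "\<nexists>a. E (v @ [a])"
    then have fin: "finite (\<Union>a\<in>A. (#) a ` {u. (v @ [a]) @ u \<in> P})"
      using A(1) unfolding E_def by blast
    have "{u. v @ u \<in> P} \<subseteq> insert [] (\<Union>a\<in>A. (#) a ` {u. (v @ [a]) @ u \<in> P})"
    proof
      fix u assume u: "u \<in> {u. v @ u \<in> P}"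
      then have "set u \<subseteq> A" using A(2) by auto
      with u show "u \<in> insert [] (\<Union>a\<in>A. (#) a ` {u. (v @ [a]) @ u \<in> P})"
        by (cases u) auto
    qed
    with fin that show False unfolding E_def by (meson finite.insertI finite_subset)
  qed
  have "\<exists>V. \<forall>n. (length (V n) = n \<and> E (V n)) \<and> (\<exists>a. V (Suc n) = V n @ [a])"
  proof (rule dependent_nat_choice)
    show "\<exists>v. length v = 0 \<and> E v" using inf by (auto simp: E_def)
  next
    fix v n assume "length v = n \<and> E v"
    then show "\<exists>v'. (length v' = Suc n \<and> E v') \<and> (\<exists>a. v' = v @ [a])"
      using step[of v] by (metis length_append_singleton)
  qed
  then obtain V where V: "\<And>n. length (V n) = n" "\<And>n. E (V n)" "\<And>n. \<exists>a. V (Suc n) = V n @ [a]"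
    by blast
  define w where "w n = last (V (Suc n))" for n
  have "map w [0..<n] = V n" for n
  proof (induction n)
    case (Suc n)
    obtain a where "V (Suc n) = V n @ [a]" using V(3) by blast
    with Suc show ?case by (simp add: w_def)
  qed (use V(1)[of 0] in simp)
  moreover have "V n \<in> P" for n
    using V(2)[of n] prefix unfolding E_def by (metis (mono_tags, lifting) Collect_empty_eq finite.emptyI)
  ultimately show ?thesis by metis
qed

section \<open>Recurrent factors and periodicity of an infinite word\<close>

definition segment :: "(nat \<Rightarrow> 'a) \<Rightarrow> nat \<Rightarrow> nat \<Rightarrow> 'a list" where
  "segment w i m = map w [i..<i + m]"

text \<open>Occurring infinitely often means that an occurrence can be found beyond any given
  position; \<open>shirshov\<close> places its blocks that way.\<close>

definition recurrent_factors :: "(nat \<Rightarrow> 'a) \<Rightarrow> nat \<Rightarrow> 'a list set" where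
  "recurrent_factors w m = {v. \<exists>\<^sub>\<infinity>i. segment w i m = v}"

lemma length_segment [simp]: "length (segment w i m) = m"
  by (simp add: segment_def)

lemma segment_split: "segment w i (m + k) = segment w i m @ segment w (i + m) k"
  using upt_add_eq_append[of i "i + m" k] by (simp add: segment_def add.assoc)

lemma segment_Suc: "segment w i (Suc m) = segment w i m @ [w (i + m)]"
  by (simp add: segment_def)

lemma segment_Suc': "segment w i (Suc m) = w i # segment w (Suc i) m"
  by (simp add: segment_def upt_conv_Cons del: upt_Suc)

lemma segment_in_lists: "range w \<subseteq> A \<Longrightarrow> segment w i m \<in> {v. set v \<subseteq> A \<and> length v = m}"
  by (auto simp: segment_def)

lemma finite_recurrent_factors:
  assumes "finite A" "range w \<subseteq> A"
  shows "finite (recurrent_factors w m)"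
proof (rule finite_subset)
  show "recurrent_factors w m \<subseteq> {v. set v \<subseteq> A \<and> length v = m}"
  proof
    fix v assume "v \<in> recurrent_factors w m"
    then obtain i where "v = segment w i m"
      unfolding recurrent_factors_def by (auto dest: INFM_EX)
    then show "v \<in> {v. set v \<subseteq> A \<and> length v = m}"
      using segment_in_lists[OF assms(2)] by blast
  qed
  show "finite {v. set v \<subseteq> A \<and> length v = m}"
    by (rule finite_lists_length_eq[OF assms(1)])
qed

lemma eventually_recurrent:
  assumes "finite A" "range w \<subseteq> A"
  shows "\<exists>N. \<forall>i\<ge>N. segment w i m \<in> recurrent_factors w m"
proof -
  let ?L = "{v. set v \<subseteq> A \<and> length v = m}"
  have "\<forall>v\<in>?L - recurrent_factors w m. \<forall>\<^sub>\<infinity>i. segment w i m \<noteq> v"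
    by (auto simp: recurrent_factors_def not_INFM)
  then have "\<forall>\<^sub>\<infinity>i. \<forall>v\<in>?L - recurrent_factors w m. segment w i m \<noteq> v"
    by (subst eventually_ball_finite_distrib) (auto intro: finite_lists_length_eq[OF assms(1)])
  then obtain N where "\<And>i v. i \<ge> N \<Longrightarrow> v\<in>?L - recurrent_factors w m \<Longrightarrow> segment w i m \<noteq> v"
    unfolding MOST_nat_le by blast
  then show ?thesis
    using segment_in_lists[OF assms(2)] by blast
qed

text \<open>A recurrent factor can be prolonged because every segment far enough out is recurrent.
  So truncation is onto, and the number of recurrent factors cannot drop as the length
  grows.\<close>

lemma recurrent_factors_Suc:
  assumes "finite A" "range w \<subseteq> A"
  shows "take m ` recurrent_factors w (Suc m) = recurrent_factors w m"
proof (intro equalityI subsetI)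
  fix v assume "v \<in> take m ` recurrent_factors w (Suc m)"
  then obtain u where u: "\<exists>\<^sub>\<infinity>i. segment w i (Suc m) = u" "v = take m u"
    unfolding recurrent_factors_def by blast
  show "v \<in> recurrent_factors w m"
    unfolding recurrent_factors_def
    by (rule CollectI, rule INFM_mono[OF u(1)]) (auto simp: u(2) segment_Suc)
next
  fix v assume v: "v \<in> recurrent_factors w m"
  obtain N where N: "\<forall>i\<ge>N. segment w i (Suc m) \<in> recurrent_factors w (Suc m)"
    using eventually_recurrent[OF assms] by blast
  obtain i where "i \<ge> N" "segment w i m = v"
    using v unfolding recurrent_factors_def INFM_nat_le by blast
  with N show "v \<in> take m ` recurrent_factors w (Suc m)"
    by (intro image_eqI[of _ _ "segment w i (Suc m)"]) (auto simp: segment_Suc)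
qed

text \<open>With boundedly many recurrent factors of each length, recurrent factors of some length
  extend uniquely to the right, so a tail of the word is generated deterministically.\<close>

lemma eventually_periodic:
  assumes A: "finite A" "range w \<subseteq> A" and bound: "\<And>m. card (recurrent_factors w m) < D"
  shows "\<exists>N p. p > 0 \<and> (\<forall>i\<ge>N. w (i + p) = w i)"
proof -
  note fin = finite_recurrent_factors[OF A]
  have "\<exists>m. card (recurrent_factors w m) = card (recurrent_factors w (Suc m))"
  proof (rule ccontr)
    assume "\<nexists>m. card (recurrent_factors w m) = card (recurrent_factors w (Suc m))"
    moreover have "card (recurrent_factors w m) \<le> card (recurrent_factors w (Suc m))" for m
      using card_image_le[OF fin, of "take m" "Suc m"] by (simp add: recurrent_factors_Suc[OF A])
    ultimately have "strict_mono (\<lambda>m. card (recurrent_factors w m))"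
      unfolding strict_mono_Suc_iff by (metis le_neq_implies_less)
    then have "D \<le> card (recurrent_factors w D)"
      by (rule strict_mono_imp_increasing)
    with bound[of D] show False by simp
  qed
  then obtain m where m: "card (recurrent_factors w m) = card (recurrent_factors w (Suc m))" by blast
  have inj: "inj_on (take m) (recurrent_factors w (Suc m))"
    by (rule eq_card_imp_inj_on[OF fin]) (simp add: recurrent_factors_Suc[OF A] m)
  obtain N where N: "\<And>i. i \<ge> N \<Longrightarrow> segment w i (Suc m) \<in> recurrent_factors w (Suc m)"
    using eventually_recurrent[OF A] by blast
  have det: "segment w (Suc i) m = segment w (Suc j) m \<and> w i = w j \<and> w (i + m) = w (j + m)"
    if "segment w i m = segment w j m" "i \<ge> N" "j \<ge> N" for i j
  proof -
    have "segment w i (Suc m) = segment w j (Suc m)"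
      by (rule inj_onD[OF inj _ N[OF that(2)] N[OF that(3)]]) (simp add: segment_Suc that(1))
    then show ?thesis
      by (metis append1_eq_conv list.inject segment_Suc segment_Suc')
  qed
  \<comment> \<open>Infinitely many positions share finitely many segments of length
    \<open>m\<close>. Two positions with the same segment continue alike, and their distance is a
    period.\<close>
  have "\<not> inj_on (\<lambda>i. segment w i m) {N..}"
  proof
    assume "inj_on (\<lambda>i. segment w i m) {N..}"
    moreover have "finite ((\<lambda>i. segment w i m) ` {N..})"
      by (rule finite_subset[OF _ finite_lists_length_eq[OF A(1), of m]])
        (use segment_in_lists[OF A(2)] in blast)
    ultimately show False using finite_imageD infinite_Ici by blast
  qed
  then obtain i j where ij: "N \<le> i" "i < j" "segment w i m = segment w j m"
    unfolding inj_on_def by (metis atLeast_iff linorder_neqE_nat)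
  have per: "segment w (i + t) m = segment w (j + t) m" for t
  proof (induction t)
    case (Suc t)
    then show ?case using det[of "i + t" "j + t"] ij by simp
  qed (use ij in simp)
  show ?thesis
  proof (rule exI[of _ i], rule exI[of _ "j - i"], intro conjI allI impI)
    fix k assume "k \<ge> i"
    then obtain t where k: "k = i + t" using le_Suc_ex by blast
    then have "w k = w (j + t)" using det[OF per[of t]] ij by simp
    then show "w (k + (j - i)) = w k" using ij k by (simp add: add.commute)
  qed (use ij in simp)
qed

lemma periodic_segment:
  assumes "\<And>i. i \<ge> N \<Longrightarrow> w (i + p) = w i"
  shows "concat (replicate k (segment w N p)) = segment w N (k * p)"
proof (induction k)
  case (Suc k)
  have "w (N + p + i) = w (N + i)" for i
    using assms[of "N + i"] by (simp add: add.assoc add.commute[of p])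
  then have "segment w (N + p) (k * p) = segment w N (k * p)"
    unfolding segment_def by (intro nth_equalityI) simp_all
  with Suc show ?case by (simp add: segment_split)
qed (simp add: segment_def)

section \<open>Rearranging decreasing blocks\<close>

text \<open>The order on lists compares lengths first and only then lexicographically, so the tails
  need equal length for the heads to decide.\<close>

lemma append_less_append:
  fixes u v :: "'a::linorder list"
  assumes "u < v" "length u = length v" "length x = length y"
  shows "u @ x < v @ y"
  using lenlex_append1[of u v "{(u, v). u < v}" x y] assms unfolding list_less_def by blast

lemma length_concat_permuted:
  assumes "\<sigma> permutes {..<D}"
  shows "length (concat (map (x \<circ> \<sigma>) [0..<D])) = length (concat (map x [0..<D]))"
proof -
  have "length (concat (map y [0..<D])) = (\<Sum>i<D. length (y i))" for y :: "nat \<Rightarrow> 'a list"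
    by (simp add: length_concat comp_def interv_sum_list_conv_sum_set_nat atLeast0LessThan)
  then show ?thesis
    using sum.permute[OF assms, of "\<lambda>i. length (x i)"] by (simp add: comp_def)
qed

text \<open>At the first index moved by \<open>\<sigma>\<close> a later block comes forward, and its
  prefix of length \<open>m\<close> is smaller. The blocks before it agree and the total length is
  unchanged, so this place decides the comparison.\<close>

lemma decreasing_blocks_permute_less:
  fixes x :: "nat \<Rightarrow> 'a::linorder list"
  assumes \<sigma>: "\<sigma> permutes {..<D}" "\<sigma> \<noteq> id"
    and dec: "\<And>i j. i < j \<Longrightarrow> j < D \<Longrightarrow> take m (x j) < take m (x i)"
    and len: "\<And>i. i < D \<Longrightarrow> m \<le> length (x i)"
  shows "concat (map (x \<circ> \<sigma>) [0..<D]) < concat (map x [0..<D])"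
proof -
  define i where "i = (LEAST i. \<sigma> i \<noteq> i)"
  have "\<exists>i. \<sigma> i \<noteq> i" using \<sigma>(2) by auto
  then have i: "\<sigma> i \<noteq> i"
    unfolding i_def by (rule LeastI_ex)
  have below: "\<And>j. j < i \<Longrightarrow> \<sigma> j = j"
    unfolding i_def using not_less_Least by blast
  have iD: "i < D" using i \<sigma>(1) by (metis lessThan_iff permutes_not_in)
  then have \<sigma>D: "\<sigma> i < D" using permutes_in_image[OF \<sigma>(1)] by simp
  have gt: "i < \<sigma> i"
    using i below[of "\<sigma> i"] permutes_inj[OF \<sigma>(1)] by (metis injD linorder_neqE_nat)
  have split: "[0..<D] = [0..<i] @ i # [Suc i..<D]"
    using upt_add_eq_append[of 0 i "D - i"] iD by (simp add: upt_conv_Cons)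
  let ?r = "\<lambda>y. drop m (y i) @ concat (map y [Suc i..<D])"
  have dec': "concat (map y [0..<D]) = concat (map y [0..<i]) @ take m (y i) @ ?r y" for y :: "nat \<Rightarrow> 'a list"
    unfolding split by simp
  have same: "map (x \<circ> \<sigma>) [0..<i] = map x [0..<i]" using below by simp
  have "length (?r (x \<circ> \<sigma>)) = length (?r x)"
    using length_concat_permuted[OF \<sigma>(1), of x] len[OF iD] len[OF \<sigma>D]
    unfolding dec'[of x] dec'[of "x \<circ> \<sigma>"] same by simp
  then have "take m ((x \<circ> \<sigma>) i) @ ?r (x \<circ> \<sigma>) < take m (x i) @ ?r x"
    using dec[OF gt \<sigma>D] len[OF iD] len[OF \<sigma>D] by (intro append_less_append) auto
  then show ?thesis
    unfolding dec'[of x] dec'[of "x \<circ> \<sigma>"] same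
    unfolding list_less_def by (subst lenlex_append2) (auto simp: irrefl_def)
qed

lemma concat_segments:
  assumes "\<And>i. p i \<le> p (Suc i)"
  shows "concat (map (\<lambda>i. segment w (p i) (p (Suc i) - p i)) [0..<D]) = segment w (p 0) (p D - p 0)"
proof (induction D)
  case (Suc D)
  have "p 0 \<le> p D" using assms by (rule lift_Suc_mono_le) simp
  then have "p (Suc D) - p 0 = (p D - p 0) + (p (Suc D) - p D)" using assms[of D] by simp
  then have "segment w (p 0) (p (Suc D) - p 0) =
      segment w (p 0) (p D - p 0) @ segment w (p D) (p (Suc D) - p D)"
    using \<open>p 0 \<le> p D\<close> by (simp only: segment_split le_add_diff_inverse)
  with Suc show ?case by simp
qed (simp add: segment_def)

text \<open>Blocks starting with distinct recurrent factors of one length, in decreasing order, can be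
  found along the word, and any rearrangement of them is lexicographically smaller.\<close>

theorem shirshov:
  fixes P :: "'a::linorder list set"
  assumes A: "finite A" "P \<subseteq> lists A" and inf: "infinite P"
    and factor: "\<And>x u y. x @ u @ y \<in> P \<Longrightarrow> u \<in> P"
  shows "(\<exists>u. u \<noteq> [] \<and> (\<forall>k. concat (replicate k u) \<in> P)) \<or>
    (\<exists>x. concat (map x [0..<D]) \<in> P \<and>
      (\<forall>\<sigma>. \<sigma> permutes {..<D} \<and> \<sigma> \<noteq> id \<longrightarrow> concat (map (x \<circ> \<sigma>) [0..<D]) < concat (map x [0..<D])))"
proof -
  have prefix: "u \<in> P" if "u @ v \<in> P" for u v
    using factor[of "[]" u v] that by simp
  obtain w where w: "\<And>n. map w [0..<n] \<in> P"
    using prefix_closed_infinite_branch[OF A inf] prefix by metis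
  have seg: "segment w i m \<in> P" for i m
  proof -
    have "segment w 0 (i + m) \<in> P" using w[of "i + m"] by (simp add: segment_def)
    then show ?thesis using factor[of "segment w 0 i" "segment w i m" "[]"] by (simp add: segment_split)
  qed
  have "set (segment w i 1) \<subseteq> A" for i using seg A(2) by blast
  then have wA: "range w \<subseteq> A" by (auto simp: segment_def)
  show ?thesis
  proof (cases "\<forall>m. card (recurrent_factors w m) < D")
    case True
    then obtain N p where p: "p > 0" "\<And>i. i \<ge> N \<Longrightarrow> w (i + p) = w i"
      using eventually_periodic[OF A(1) wA] by metis
    have "\<forall>k. concat (replicate k (segment w N p)) \<in> P"
      using periodic_segment[of N w p] p(2) seg by simp
    then show ?thesis using p(1) by (metis length_segment list.size(3) less_irrefl)
  next
    case False
    then obtain m where "D \<le> card (recurrent_factors w m)" by (meson not_le)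
    then obtain T where T: "T \<subseteq> recurrent_factors w m" "card T = D" "finite T"
      using obtain_subset_with_card_n by metis
    define v where "v i = rev (sorted_list_of_set T) ! i" for i
    have lenv: "length (rev (sorted_list_of_set T)) = D" using T by simp
    have v_dec: "v j < v i" if "i < j" "j < D" for i j
      using that T sorted_wrt_nth_less[OF strict_sorted_list_of_set[of T], of "D - Suc j" "D - Suc i"]
      by (simp add: v_def rev_nth)
    have v_rec: "\<exists>\<^sub>\<infinity>n. segment w n m = v i" if "i < D" for i
    proof -
      have "v i \<in> set (rev (sorted_list_of_set T))" unfolding v_def using that lenv by (metis nth_mem)
      then show ?thesis using T unfolding recurrent_factors_def by auto
    qed
    \<comment> \<open>Recurrence lets each prefix be sought beyond the previous one. The cut point
      \<open>p D\<close> only closes the last block, hence the guard \<open>i < D\<close>.\<close>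
    have "\<exists>p. \<forall>i. (i < D \<longrightarrow> segment w (p i) m = v i) \<and> p i + m \<le> p (Suc i)"
    proof (rule dependent_nat_choice)
      show "\<exists>n. 0 < D \<longrightarrow> segment w n m = v 0" using v_rec INFM_EX by blast
    next
      fix q i
      show "\<exists>n. (Suc i < D \<longrightarrow> segment w n m = v (Suc i)) \<and> q + m \<le> n"
        using v_rec[of "Suc i"] unfolding INFM_nat_le by blast
    qed
    then obtain p where p: "\<And>i. i < D \<Longrightarrow> segment w (p i) m = v i" "\<And>i. p i + m \<le> p (Suc i)"
      by blast
    define x where "x i = segment w (p i) (p (Suc i) - p i)" for i
    have mono: "p i \<le> p (Suc i)" for i using p(2)[of i] by simp
    have takex: "take m (x i) = v i" if "i < D" for i
    proof -
      have "p (Suc i) - p i = m + (p (Suc i) - p i - m)" using p(2)[of i] by simp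
      then have "x i = segment w (p i) m @ segment w (p i + m) (p (Suc i) - p i - m)"
        unfolding x_def by (metis segment_split)
      then show ?thesis by (simp flip: p(1)[OF that])
    qed
    have "concat (map x [0..<D]) \<in> P"
      unfolding x_def concat_segments[of p, OF mono] by (rule seg)
    moreover have "concat (map (x \<circ> \<sigma>) [0..<D]) < concat (map x [0..<D])"
      if "\<sigma> permutes {..<D} \<and> \<sigma> \<noteq> id" for \<sigma>
    proof (rule decreasing_blocks_permute_less)
      show "take m (x j) < take m (x i)" if "i < j" "j < D" for i j
        using that v_dec takex by simp
      show "m \<le> length (x i)" for i using p(2)[of i] by (simp add: x_def)
    qed (use that in auto)
    ultimately show ?thesis by blast
  qed
qed

section \<open>Finiteness of periodic groups in rings with a standard identity\<close>

interpretation int_module: Modules.module "\<lambda>(k::int) (x::'r::ring_1). of_int k * x"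
  by standard (simp_all add: algebra_simps)

lemma mult_of_int_left_commute: "x * (of_int k * y) = of_int k * (x * y)" for x y :: "'r::ring_1"
  by (metis mult.assoc mult_of_int_commute)

(* As a simplification rule it would loop with of_int_mult and mult.assoc. *)
declare int_module.scale_scale [simp del]

definition standard_polynomial :: "nat \<Rightarrow> (nat \<Rightarrow> 'r::ring_1) \<Rightarrow> 'r" where
  "standard_polynomial D x =
     (\<Sum>\<sigma> | \<sigma> permutes {..<D}. of_int (sign \<sigma>) * prod_list (map (x \<circ> \<sigma>) [0..<D]))"

text \<open>Normal words as for Groebner bases, but defined through their values, so that no
  rewriting system has to be named.\<close>

definition reduced_words :: "('b::linorder \<Rightarrow> 'r::ring_1) \<Rightarrow> 'b set \<Rightarrow> 'b list set" where
  "reduced_words g A = {w \<in> lists A.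
     prod_list (map g w) \<notin> int_module.span ((\<lambda>v. prod_list (map g v)) ` {v \<in> lists A. v < w})}"

text \<open>Comparing lengths first is what makes this hold: in the dictionary order, appending a
  suffix can reverse the order of a word and its proper prefix.\<close>

lemma append_less_mono:
  fixes u v :: "'a::linorder list"
  assumes "v < u"
  shows "x @ v @ y < x @ u @ y"
proof (cases "length v = length u")
  case True
  then show ?thesis
    using append_less_append[OF assms True, of y y]
    unfolding list_less_def by (subst lenlex_append2) (auto simp: irrefl_def)
next
  case False
  then have "length v < length u" using assms unfolding list_less_def lenlex_conv by auto
  then show ?thesis unfolding list_less_def lenlex_conv by simp
qed

text \<open>Induction along the order of words, which is well-founded because the alphabet is
  well-ordered.\<close>

lemma word_in_span_reduced:
  fixes w :: "'b::wellorder list"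
  assumes "w \<in> lists A"
  shows "prod_list (map g w) \<in> int_module.span ((\<lambda>v. prod_list (map g v)) ` reduced_words g A)"
  using assms
proof (induction w rule: less_induct)
  case (less w)
  show ?case
  proof (cases "w \<in> reduced_words g A")
    case True
    then show ?thesis by (blast intro: int_module.span_base)
  next
    case False
    have "int_module.span ((\<lambda>v. prod_list (map g v)) ` {v \<in> lists A. v < w})
        \<subseteq> int_module.span ((\<lambda>v. prod_list (map g v)) ` reduced_words g A)"
      using less.IH by (intro int_module.span_minimal int_module.subspace_span) blast
    with False less.prems show ?thesis unfolding reduced_words_def by blast
  qed
qed

text \<open>A relation that rewrites \<open>u\<close> by smaller words rewrites
  \<open>x @ u @ y\<close> as well after multiplication on both sides.\<close>

lemma reduced_words_factor:
  assumes "x @ u @ y \<in> reduced_words g A"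
  shows "u \<in> reduced_words g A"
proof (rule ccontr)
  let ?ev = "\<lambda>v. prod_list (map g v)"
  let ?S = "int_module.span (?ev ` {v \<in> lists A. v < x @ u @ y})"
  assume u: "u \<notin> reduced_words g A"
  have xuy: "x \<in> lists A" "u \<in> lists A" "y \<in> lists A" and nred: "?ev (x @ u @ y) \<notin> ?S"
    using assms by (auto simp: reduced_words_def)
  have "int_module.subspace {z. ?ev x * z * ?ev y \<in> ?S}"
    by (rule int_module.subspaceI)
      (simp_all add: int_module.span_zero distrib_left distrib_right int_module.span_add
        mult_of_int_left_commute mult.assoc int_module.span_scale)
  moreover have "?ev x * ?ev v * ?ev y \<in> ?S" if v: "v \<in> lists A" "v < u" for v
  proof -
    have "?ev (x @ v @ y) \<in> ?S"
      using v xuy append_less_mono[OF v(2)] by (intro int_module.span_base imageI) auto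
    then show ?thesis by (simp add: mult.assoc)
  qed
  ultimately have "int_module.span (?ev ` {v \<in> lists A. v < u}) \<subseteq> {z. ?ev x * z * ?ev y \<in> ?S}"
    by (intro int_module.span_minimal) blast+
  with u xuy have "?ev x * ?ev u * ?ev y \<in> ?S" unfolding reduced_words_def by blast
  with nred show False by (simp add: mult.assoc)
qed

lemma prod_list_map_concat: "prod_list (map g (concat ws)) = prod_list (map (\<lambda>w. prod_list (map g w)) ws)"
  by (induction ws) simp_all

lemma finite_reduced_words:
  fixes g :: "'b::wellorder \<Rightarrow> 'r::ring_1"
  assumes A: "finite A"
    and periodic: "\<And>w. w \<in> lists A \<Longrightarrow> \<exists>k>0. prod_list (map g w) ^ k = 1"
    and identity: "\<And>x. (\<And>i. i < D \<Longrightarrow> x i \<in> lists A) \<Longrightarrow>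
      standard_polynomial D (\<lambda>i. prod_list (map g (x i))) = 0"
  shows "finite (reduced_words g A)"
proof (rule ccontr)
  let ?ev = "\<lambda>v. prod_list (map g v)"
  let ?P = "reduced_words g A"
  assume "infinite ?P"
  moreover have PA: "?P \<subseteq> lists A" by (auto simp: reduced_words_def)
  ultimately consider u where "u \<noteq> []" "\<And>k. concat (replicate k u) \<in> ?P"
    | x where "concat (map x [0..<D]) \<in> ?P"
      "\<And>\<sigma>. \<sigma> permutes {..<D} \<Longrightarrow> \<sigma> \<noteq> id \<Longrightarrow> concat (map (x \<circ> \<sigma>) [0..<D]) < concat (map x [0..<D])"
    using shirshov[OF A, of ?P D] reduced_words_factor[of _ _ _ g A] by metis
  then show False
  proof cases
    case 1
    have "u \<in> lists A" using 1(2)[of 1] PA by auto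
    then obtain k where k: "k > 0" "?ev u ^ k = 1" using periodic by blast
    let ?w = "concat (replicate k u)"
    \<comment> \<open>The exponent \<open>k\<close> turns the power into a word with the value of
      the empty word, so it is not reduced.\<close>
    have "?ev ?w = ?ev []" using k(2) by (simp add: prod_list_map_concat)
    moreover have "[] < ?w" using k(1) 1(1) by (simp add: list_less_def)
    ultimately have "?ev ?w \<in> int_module.span (?ev ` {v \<in> lists A. v < ?w})"
      by (intro int_module.span_base image_eqI[of _ _ "[]"]) auto
    with 1(2)[of k] show False by (simp add: reduced_words_def)
  next
    case 2
    let ?w = "concat (map x [0..<D])"
    let ?S = "int_module.span (?ev ` {v \<in> lists A. v < ?w})"
    have xA: "x i \<in> lists A" if "i < D" for i
      using 2(1) PA that by fastforce
    have ev: "?ev (concat (map (x \<circ> \<sigma>) [0..<D])) = prod_list (map ((\<lambda>i. ?ev (x i)) \<circ> \<sigma>) [0..<D])" for \<sigma>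
      by (simp add: prod_list_map_concat comp_def)
    have "0 = standard_polynomial D (\<lambda>i. ?ev (x i))"
      using identity xA by simp
    also have "\<dots> = ?ev ?w +
        (\<Sum>\<sigma> \<in> {\<sigma>. \<sigma> permutes {..<D}} - {id}. of_int (sign \<sigma>) * ?ev (concat (map (x \<circ> \<sigma>) [0..<D])))"
      unfolding standard_polynomial_def ev using ev[of id]
      by (subst sum.remove[of _ id]) (simp_all add: finite_permutations permutes_id)
    finally have "?ev ?w =
        - (\<Sum>\<sigma> \<in> {\<sigma>. \<sigma> permutes {..<D}} - {id}. of_int (sign \<sigma>) * ?ev (concat (map (x \<circ> \<sigma>) [0..<D])))"
      by (simp add: eq_neg_iff_add_eq_0)
    also have "\<dots> \<in> ?S"
    proof (intro int_module.span_neg int_module.span_sum int_module.span_scale int_module.span_base imageI)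
      fix \<sigma> assume \<sigma>: "\<sigma> \<in> {\<sigma>. \<sigma> permutes {..<D}} - {id}"
      then have x\<sigma>: "x (\<sigma> i) \<in> lists A" if "i < D" for i
        using permutes_in_image[of \<sigma> "{..<D}" i] that xA by simp
      then show "concat (map (x \<circ> \<sigma>) [0..<D]) \<in> {v \<in> lists A. v < ?w}"
        using 2(2) \<sigma> x\<sigma> by (simp add: in_lists_conv_set)
    qed
    finally show False using 2(1) by (simp add: reduced_words_def)
  qed
qed

section \<open>Residues modulo an integer and Minkowski's argument\<close>

text \<open>Division with remainder in each coefficient. The remainders \<open>c\<close> label
  cosets of \<open>m\<close> times the span, and there are finitely many labels.\<close>

lemma span_residues:
  fixes B :: "'r::ring_1 set" and m :: int
  assumes "finite B" "m > 0" "x \<in> int_module.span B"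
  shows "\<exists>c. c \<in> B \<rightarrow>\<^sub>E {0..<m} \<and>
    (\<exists>y \<in> int_module.span B. x = (\<Sum>b\<in>B. of_int (c b) * b) + of_int m * y)"
proof -
  obtain u where u: "x = (\<Sum>b\<in>B. of_int (u b) * b)"
    using assms(3) int_module.span_finite[OF assms(1)] by auto
  define c where "c = restrict (\<lambda>b. u b mod m) B"
  let ?y = "\<Sum>b\<in>B. of_int (u b div m) * b"
  have "x = (\<Sum>b\<in>B. of_int (c b + m * (u b div m)) * b)"
    unfolding u by (intro sum.cong refl) (simp add: c_def)
  also have "\<dots> = (\<Sum>b\<in>B. of_int (c b) * b) + of_int m * ?y"
    unfolding of_int_add of_int_mult distrib_right sum.distrib sum_distrib_left mult.assoc ..
  finally have "x = (\<Sum>b\<in>B. of_int (c b) * b) + of_int m * ?y" .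
  moreover have "?y \<in> int_module.span B"
    by (intro int_module.span_sum int_module.span_scale int_module.span_base)
  moreover have "c \<in> B \<rightarrow>\<^sub>E {0..<m}" using assms(2) by (auto simp: c_def)
  ultimately show ?thesis by blast
qed

text \<open>Elements with the same label differ by \<open>m\<close> times an element of the span, so
  \<open>sep\<close> makes the labelling injective.\<close>

lemma finite_if_separated_mod:
  fixes B M :: "'r::ring_1 set" and m :: int
  assumes B: "finite B" and m: "m > 0" and M: "M \<subseteq> int_module.span B"
    and sep: "\<And>x y z. x \<in> M \<Longrightarrow> y \<in> M \<Longrightarrow> z \<in> int_module.span B \<Longrightarrow> x - y = of_int m * z \<Longrightarrow> x = y"
  shows "finite M"
proof -
  have "\<forall>x\<in>M. \<exists>c. c \<in> B \<rightarrow>\<^sub>E {0..<m} \<and>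
      (\<exists>y \<in> int_module.span B. x = (\<Sum>b\<in>B. of_int (c b) * b) + of_int m * y)"
    using span_residues[OF B m] M by blast
  from bchoice[OF this] obtain c where c: "\<And>x. x \<in> M \<Longrightarrow> c x \<in> B \<rightarrow>\<^sub>E {0..<m}"
      "\<And>x. x \<in> M \<Longrightarrow> \<exists>y \<in> int_module.span B. x = (\<Sum>b\<in>B. of_int (c x b) * b) + of_int m * y"
    by blast
  have "inj_on c M"
  proof
    fix x y assume xy: "x \<in> M" "y \<in> M" "c x = c y"
    obtain x' y' where x': "x' \<in> int_module.span B" "x = (\<Sum>b\<in>B. of_int (c x b) * b) + of_int m * x'"
      and y': "y' \<in> int_module.span B" "y = (\<Sum>b\<in>B. of_int (c y b) * b) + of_int m * y'"
      using c(2) xy by blast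
    have "x - y = of_int m * (x' - y')" by (subst x'(2), subst y'(2)) (simp add: xy(3) right_diff_distrib)
    then show "x = y" using sep xy int_module.span_diff[OF x'(1) y'(1)] by blast
  qed
  moreover have "finite (c ` M)"
    by (rule finite_subset[of _ "B \<rightarrow>\<^sub>E {0..<m}"]) (use c(1) B in \<open>auto intro: finite_PiE\<close>)
  ultimately show ?thesis using finite_imageD by blast
qed

text \<open>Induction on the generators. If a nonzero multiple of \<open>b\<close> lies in the span
  of the others, multiplying by it removes \<open>b\<close>; otherwise the coefficient of
  \<open>b\<close> is unique, divisible by all powers of \<open>q\<close>, and hence 0.\<close>

lemma infinitely_divisible_torsion:
  fixes B :: "'r::ring_1 set" and q :: int
  assumes "finite B" "q > 1" "\<And>t. \<exists>y \<in> int_module.span B. x = of_int (q ^ t) * y"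
  shows "\<exists>k::int. k \<noteq> 0 \<and> of_int k * x = 0"
  using assms(1,3)
proof (induction B arbitrary: x rule: finite_induct)
  case empty
  then show ?case by (metis int_module.span_empty mult_zero_right of_int_1 one_neq_zero singletonD mult_1)
next
  case (insert b B)
  show ?case
  proof (cases "\<exists>k. k \<noteq> 0 \<and> of_int k * b \<in> int_module.span B")
    case True
    then obtain k where k: "k \<noteq> 0" "of_int k * b \<in> int_module.span B" by blast
    have scaled: "of_int k * y \<in> int_module.span B" if "y \<in> int_module.span (insert b B)" for y
    proof -
      obtain j where "y - of_int j * b \<in> int_module.span B"
        using \<open>y \<in> _\<close> int_module.span_breakdown_eq by blast
      then have "of_int k * (y - of_int j * b) + of_int j * (of_int k * b) \<in> int_module.span B"
        using int_module.span_add[OF int_module.span_scale int_module.span_scale[OF k(2)]] by blast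
      moreover have "of_int k * (y - of_int j * b) + of_int j * (of_int k * b) = of_int k * y"
        by (simp only: right_diff_distrib int_module.scale_scale mult.commute[of j k] diff_add_cancel)
      ultimately show ?thesis by simp
    qed
    have "\<exists>y \<in> int_module.span B. of_int k * x = of_int (q ^ t) * y" for t
    proof -
      obtain y where "y \<in> int_module.span (insert b B)" "x = of_int (q ^ t) * y"
        using insert.prems by blast
      then show ?thesis
        using scaled by (intro bexI[of _ "of_int k * y"]) (simp_all add: mult_of_int_left_commute)
    qed
    from insert.IH[OF this] obtain l :: int where "l \<noteq> 0" "of_int l * (of_int k * x) = 0" by blast
    with k(1) show ?thesis by (intro exI[of _ "l * k"]) (simp add: mult.assoc)
  next
    case False
    obtain j where j: "x - of_int j * b \<in> int_module.span B"
      using insert.prems[of 0] int_module.span_breakdown_eq by fastforce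
    have ex: "\<exists>y i. y \<in> int_module.span B \<and> j = q ^ t * i \<and> x - of_int j * b = of_int (q ^ t) * y" for t
    proof -
      obtain y i where y: "x = of_int (q ^ t) * y" "y - of_int i * b \<in> int_module.span B"
        using insert.prems[of t] int_module.span_breakdown_eq by blast
      have "of_int (q ^ t) * (y - of_int i * b) - (x - of_int j * b) \<in> int_module.span B"
        by (rule int_module.span_diff[OF int_module.span_scale[OF y(2)] j])
      then have "of_int (j - q ^ t * i) * b \<in> int_module.span B"
        by (simp add: y(1) right_diff_distrib left_diff_distrib mult.assoc)
      with False have "j = q ^ t * i" by (metis eq_iff_diff_eq_0)
      with y show ?thesis by (intro exI[of _ "y - of_int i * b"] exI[of _ i]) (simp add: right_diff_distrib mult.assoc)
    qed
    have "j = 0"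
    proof (rule ccontr)
      assume "j \<noteq> 0"
      \<comment> \<open>The exponent \<open>nat \<bar>j\<bar>\<close> is chosen to make the power
        exceed \<open>\<bar>j\<bar>\<close>, which a divisor of a nonzero \<open>j\<close> cannot
        do.\<close>
      have "\<bar>j\<bar> < q ^ nat \<bar>j\<bar>"
        using of_nat_less_two_power[where 'a=int, of "nat \<bar>j\<bar>"] power_mono[of 2 q "nat \<bar>j\<bar>"] assms(2) by auto
      moreover obtain i where "j = q ^ nat \<bar>j\<bar> * i" using ex by blast
      ultimately show False using \<open>j \<noteq> 0\<close> by (metis dvd_imp_le_int dvd_triv_left linorder_not_less abs_of_pos abs_ge_zero order.strict_trans1)
    qed
    then show ?thesis using insert.IH[of x] ex by auto
  qed
qed

text \<open>The binomial expansion to first order. Keeping the remainder as a multiple of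
  \<open>s * s\<close> by an element of \<open>L\<close> makes later divisibility statements hold
  inside \<open>L\<close>.\<close>

lemma power_one_plus_scaled:
  fixes y :: "'r::ring_1" and s :: int
  assumes L: "int_module.subspace L" and mult: "\<And>x y. x \<in> L \<Longrightarrow> y \<in> L \<Longrightarrow> x * y \<in> L" and y: "y \<in> L"
  shows "\<exists>z\<in>L. (1 + of_int s * y) ^ k = 1 + of_int (int k * s) * y + of_int (s * s) * z"
proof (induction k)
  case 0
  then show ?case using int_module.subspace_0[OF L] by (intro bexI[of _ 0]) auto
next
  case (Suc k)
  then obtain z where z: "z \<in> L" "(1 + of_int s * y) ^ k = 1 + of_int (int k * s) * y + of_int (s * s) * z"
    by blast
  let ?z = "z + of_int (int k) * (y * y) + of_int s * (y * z)"
  have expand: "(1 + of_int s * y) * (1 + of_int (c * s) * y + of_int (s * s) * z) =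
      1 + of_int ((c + 1) * s) * y + of_int (s * s) * (z + of_int c * (y * y) + of_int s * (y * z))" for c
    by (simp add: distrib_left distrib_right mult.assoc mult_of_int_left_commute[of y] add_ac
        int_module.scale_scale mult.commute[where 'a=int] mult.left_commute[where 'a=int] del: of_int_mult)
  have "(1 + of_int s * y) ^ Suc k = 1 + of_int (int (Suc k) * s) * y + of_int (s * s) * ?z"
    by (simp only: power_Suc z(2) expand of_nat_Suc add.commute[of 1 "int k"])
  moreover have "?z \<in> L"
    using z(1) y by (intro int_module.subspace_add[OF L] int_module.subspace_scale[OF L] mult)
  ultimately show ?case by blast
qed

text \<open>Minkowski's argument: a unit congruent to 1 modulo 3 is either 1 or of infinite order.\<close>

lemma power_one_plus_ne_one:
  fixes L :: "'r::ring_1 set"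
  assumes L: "int_module.subspace L" and mult: "\<And>x y. x \<in> L \<Longrightarrow> y \<in> L \<Longrightarrow> x * y \<in> L"
    and torsion_free: "\<And>(n::int) x::'r. of_int n * x = 0 \<Longrightarrow> n = 0 \<or> x = 0"
    and "k > 0" "e > 0" "y \<in> L" "\<And>z. z \<in> L \<Longrightarrow> y \<noteq> of_int 3 * z"
  shows "(1 + of_int (3 ^ e) * y) ^ k \<noteq> 1"
  using assms(4-7)
proof (induction k arbitrary: e y rule: less_induct)
  case (less k)
  note add = int_module.subspace_add[OF L] and scale = int_module.subspace_scale[OF L]
    and neg = int_module.subspace_neg[OF L]
  obtain d where e: "e = Suc d" using less.prems(2) gr0_implies_Suc by blast
  show ?case
  proof (cases "3 dvd k")
    case False
    show ?thesis
    proof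
      assume one: "(1 + of_int (3 ^ e) * y) ^ k = 1"
      obtain z where z: "z \<in> L"
          "(1 + of_int (3 ^ e) * y) ^ k = 1 + of_int (int k * 3 ^ e) * y + of_int (3 ^ e * 3 ^ e) * z"
        using power_one_plus_scaled[OF L mult less.prems(3)] by blast
      \<comment> \<open>Cancelling one factor \<open>3 ^ e\<close>, by torsion-freeness, leaves
        \<open>k\<close> times \<open>y\<close> divisible by 3 in \<open>L\<close> because
        \<open>e > 0\<close>. As \<open>k\<close> is prime to 3, so is \<open>y\<close>, a
        contradiction.\<close>
      have "of_int (3 ^ e) * (of_int (int k) * y + of_int (3 ^ e) * z) = 0"
        using one unfolding z(2) by (simp add: distrib_left mult.assoc mult_of_nat_commute)
      then have "of_int (int k) * y + of_int (3 ^ e) * z = 0"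
        using torsion_free[of "3 ^ e"] by simp
      then have ky: "of_int (int k) * y = of_int 3 * (- (of_int (3 ^ d) * z))"
        by (simp add: e mult.assoc eq_neg_iff_add_eq_0)
      have k_mod: "int k = 3 * int (k div 3) + int (k mod 3)"
        by (metis mult_div_mod_eq of_nat_add of_nat_mult of_nat_numeral)
      have "k mod 3 = 1 \<or> k mod 3 = 2" using False by presburger
      \<comment> \<open>Bezout coefficients for \<open>k\<close> and 3, one pair for each nonzero
        residue of \<open>k\<close>.\<close>
      then have "1 * int k + - int (k div 3) * 3 = 1 \<or> - 1 * int k + (int (k div 3) + 1) * 3 = 1"
        using k_mod by auto
      then obtain a b where ab: "a * int k + b * 3 = 1" by blast
      have "y = of_int (a * int k + b * 3) * y" by (simp add: ab)
      also have "\<dots> = of_int a * (of_int (int k) * y) + of_int 3 * (of_int b * y)"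
        by (simp add: distrib_right mult.assoc mult_of_int_left_commute[of 3])
      also have "\<dots> = of_int 3 * (of_int a * (- (of_int (3 ^ d) * z)) + of_int b * y)"
        unfolding ky by (simp add: distrib_left mult_of_int_left_commute[of 3])
      finally show False
        using less.prems(4)[OF add[OF scale[OF neg[OF scale[OF z(1)]]] scale[OF less.prems(3)]]] by blast
    qed
  next
    case True
    then obtain k' where k': "k = 3 * k'" by blast
    \<comment> \<open>Cubing raises \<open>e\<close> by one and replaces \<open>y\<close> by
      \<open>y'\<close>, which is congruent to \<open>y\<close> modulo 3 and so stays indivisible.
      The extra factor 3 in the higher terms comes from \<open>e > 0\<close>; squaring with 2 in
      place of 3 would lose it at \<open>e = 1\<close>.\<close>
    define y' where "y' = y + of_int 3 * (of_int (3 ^ d) * (y * y) + of_int (3 ^ (2 * d)) * (y * (y * y)))"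
    have pow: "(1 + of_int (3 ^ e) * y) ^ 3 = 1 + of_int (3 ^ Suc e) * y'"
    proof -
      have cube: "(1 + of_int s * y) ^ 3 =
          1 + of_int (s + s + s) * y + of_int (s * s + s * s + s * s) * (y * y) + of_int (s * s * s) * (y * (y * y))" for s
        by (simp only: power3_eq_cube distrib_left distrib_right mult.assoc mult_of_int_left_commute[of y] add_ac
          mult_1_left mult_1_right of_int_add
          int_module.scale_scale mult.commute[where 'a=int] mult.left_commute[where 'a=int])
      define s :: int where "s = 3 ^ e"
      have s: "s + s + s = 3 ^ Suc e" "s * s + s * s + s * s = 3 ^ Suc e * (3 * 3 ^ d)"
        "s * s * s = 3 ^ Suc e * (3 * 3 ^ (2 * d))"
        by (simp_all add: s_def e power_add mult_2)
      show ?thesis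
        unfolding s_def[symmetric] cube unfolding s y'_def
        by (simp only: distrib_left int_module.scale_scale add.assoc)
    qed
    have "y' \<in> L"
      unfolding y'_def by (intro add scale mult less.prems(3))
    moreover have "y' \<noteq> of_int 3 * z" if "z \<in> L" for z
    proof
      assume "y' = of_int 3 * z"
      then have "y = of_int 3 * (z - (of_int (3 ^ d) * (y * y) + of_int (3 ^ (2 * d)) * (y * (y * y))))"
        unfolding y'_def by (simp only: right_diff_distrib flip: eq_diff_eq)
      moreover have "z - (of_int (3 ^ d) * (y * y) + of_int (3 ^ (2 * d)) * (y * (y * y))) \<in> L"
        by (intro int_module.subspace_diff[OF L] add scale mult that less.prems(3))
      ultimately show False using less.prems(4) by metis
    qed
    ultimately have "(1 + of_int (3 ^ Suc e) * y') ^ k' \<noteq> 1"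
      using less.IH[of k' "Suc e" y'] less.prems(1) k' by simp
    then show ?thesis unfolding k' power_mult pow .
  qed
qed

text \<open>From a nonzero \<open>x\<close> a largest power \<open>3 ^ t\<close> can be extracted,
  as otherwise \<open>x\<close> would be torsion. The 3 in front of \<open>x\<close> makes the
  exponent \<open>Suc t\<close> positive, as Minkowski's step demands.\<close>

lemma periodic_congruent_one_mod_3:
  fixes B :: "'r::ring_1 set"
  assumes B: "finite B" and mult: "\<And>x y. x \<in> int_module.span B \<Longrightarrow> y \<in> int_module.span B \<Longrightarrow> x * y \<in> int_module.span B"
    and torsion_free: "\<And>(n::int) x::'r. of_int n * x = 0 \<Longrightarrow> n = 0 \<or> x = 0"
    and x: "x \<in> int_module.span B" and k: "k > 0" "(1 + of_int 3 * x) ^ k = 1"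
  shows "x = 0"
proof (rule ccontr)
  let ?L = "int_module.span B"
  assume "x \<noteq> 0"
  define Q where "Q t \<longleftrightarrow> (\<exists>y \<in> ?L. x = of_int (3 ^ t) * y)" for t
  have "\<exists>t. \<not> Q t"
  proof (rule ccontr)
    assume "\<not> ?thesis"
    then have "\<exists>y \<in> ?L. x = of_int (3 ^ t) * y" for t by (simp add: Q_def)
    from infinitely_divisible_torsion[OF B _ this] obtain n :: int where "n \<noteq> 0" "of_int n * x = 0" by auto
    with torsion_free \<open>x \<noteq> 0\<close> show False by blast
  qed
  moreover have "Q 0" using x by (simp add: Q_def)
  ultimately obtain t where "Q t" "\<not> Q (Suc t)" using nat_induct[of Q] by blast
  then obtain y where t: "y \<in> ?L" "x = of_int (3 ^ t) * y" "\<not> (\<exists>y \<in> ?L. x = of_int (3 ^ Suc t) * y)"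
    unfolding Q_def by blast
  have "y \<noteq> of_int 3 * z" if "z \<in> ?L" for z
  proof
    assume "y = of_int 3 * z"
    then have "x = of_int (3 ^ Suc t) * z"
      unfolding t(2) by (simp only: int_module.scale_scale power_Suc mult.commute[where 'a=int])
    with t(3) that show False by blast
  qed
  then have "(1 + of_int (3 ^ Suc t) * y) ^ k \<noteq> 1"
    by (intro power_one_plus_ne_one[OF int_module.subspace_span mult torsion_free k(1) _ t(1)]) auto
  with k(2) show False by (simp add: t(2) mult.assoc)
qed

text \<open>Distinct words are incongruent modulo a multiple of \<open>?L\<close>: if some
  \<open>m\<close> is 0 in the ring, because \<open>m\<close> times \<open>?L\<close> vanishes;
  otherwise modulo 3, by Minkowski's argument for the quotient of two words.\<close>

theorem finite_periodic_words:
  fixes g :: "'b::wellorder \<Rightarrow> 'r::ring_1"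
  assumes A: "finite A"
    and periodic: "\<And>w. w \<in> lists A \<Longrightarrow> \<exists>k>0. prod_list (map g w) ^ k = 1"
    and identity: "\<And>x. (\<And>i. i < D \<Longrightarrow> x i \<in> lists A) \<Longrightarrow>
      standard_polynomial D (\<lambda>i. prod_list (map g (x i))) = 0"
    and char: "(\<exists>m>0. (of_int m :: 'r) = 0) \<or> (\<forall>(n::int) x::'r. of_int n * x = 0 \<longrightarrow> n = 0 \<or> x = 0)"
  shows "finite ((\<lambda>w. prod_list (map g w)) ` lists A)"
proof -
  let ?ev = "\<lambda>w. prod_list (map g w)"
  let ?W = "?ev ` lists A"
  define B where "B = ?ev ` reduced_words g A"
  let ?L = "int_module.span B"
  have B: "finite B" unfolding B_def using finite_reduced_words[OF A periodic identity] by blast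
  have WL: "?W \<subseteq> ?L" unfolding B_def using word_in_span_reduced[of _ A g] by blast
  have BW: "B \<subseteq> ?W" unfolding B_def reduced_words_def by blast
  have WW: "x * y \<in> ?W" if "x \<in> ?W" "y \<in> ?W" for x y
  proof -
    from that obtain u v where "u \<in> lists A" "x = ?ev u" "v \<in> lists A" "y = ?ev v" by blast
    then show ?thesis by (intro image_eqI[of _ _ "u @ v"]) auto
  qed
  have periodic_W: "\<exists>k>0. x ^ k = 1" if "x \<in> ?W" for x
    using that periodic by blast
  \<comment> \<open>The span is closed under products in two stages: words times the span, then
    linearity in the left factor.\<close>
  have left: "x * y \<in> ?L" if "x \<in> ?W" "y \<in> ?L" for x y
  proof -
    have "?L \<subseteq> {y. x * y \<in> ?L}"
    proof (rule int_module.span_minimal)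
      have "x * b \<in> ?L" if "b \<in> B" for b
        by (rule subsetD[OF WL WW[OF \<open>x \<in> ?W\<close> subsetD[OF BW that]]])
      then show "B \<subseteq> {y. x * y \<in> ?L}" by blast
      show "int_module.subspace {y. x * y \<in> ?L}"
        by (rule int_module.subspaceI)
          (simp_all add: int_module.span_zero distrib_left int_module.span_add
            mult_of_int_left_commute int_module.span_scale)
    qed
    then show ?thesis using that by blast
  qed
  have mult: "x * y \<in> ?L" if "x \<in> ?L" "y \<in> ?L" for x y
  proof -
    have "?L \<subseteq> {x. x * y \<in> ?L}"
    proof (rule int_module.span_minimal)
      have "b * y \<in> ?L" if "b \<in> B" for b
        by (rule left[OF subsetD[OF BW that] \<open>y \<in> ?L\<close>])
      then show "B \<subseteq> {x. x * y \<in> ?L}" by blast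
      show "int_module.subspace {x. x * y \<in> ?L}"
        by (rule int_module.subspaceI)
          (simp_all add: int_module.span_zero distrib_right int_module.span_add
            mult.assoc int_module.span_scale)
    qed
    then show ?thesis using that by blast
  qed
  show ?thesis
  proof (cases "\<exists>m>0. (of_int m :: 'r) = 0")
    case True
    then obtain m :: int where m: "m > 0" "(of_int m :: 'r) = 0" by auto
    show ?thesis
      by (rule finite_if_separated_mod[OF B m(1) WL]) (simp add: m(2))
  next
    case False
    then have torsion_free: "of_int n * x = 0 \<Longrightarrow> n = 0 \<or> x = 0" for n :: int and x :: 'r
      using char by blast
    show ?thesis
    proof (rule finite_if_separated_mod[OF B _ WL, of 3])
      fix x y z assume x: "x \<in> ?W" and y: "y \<in> ?W" and z: "z \<in> ?L" and xy: "x - y = of_int 3 * z"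
      \<comment> \<open>Words are only closed under products, but the inverse of \<open>y\<close> is
        the power \<open>y ^ (l - 1)\<close> and thus again a word.\<close>
      obtain l where l: "l > 0" "y ^ l = 1" using periodic_W[OF y] by blast
      have pow: "y ^ n \<in> ?W" for n
      proof (induction n)
        case 0
        show ?case by (rule image_eqI[of _ _ "[]"]) auto
      qed (simp add: WW[OF y])
      define y' where "y' = y ^ (l - 1)"
      have y': "y' \<in> ?W" "y' * y = 1" "y * y' = 1"
        using pow power_minus_mult[OF l(1), of y] l(2) by (simp_all add: y'_def power_commutes)
      obtain k where k: "k > 0" "(y' * x) ^ k = 1" using periodic_W[OF WW[OF y'(1) x]] by blast
      have "y' * x = y' * (x - y) + 1" by (simp add: right_diff_distrib y'(2))
      then have "y' * x = 1 + of_int 3 * (y' * z)"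
        by (simp only: xy mult_of_int_left_commute add.commute)
      then have "y' * z = 0"
        using periodic_congruent_one_mod_3[OF B mult torsion_free left[OF y'(1) z] k(1)] k(2) by simp
      then have "z = 0" using y'(3) by (metis mult.assoc mult_1 mult_zero_right)
      then show "x = y" using xy by simp
    qed simp
  qed
qed

section \<open>The standard polynomial and linear dependence\<close>

text \<open>Composition with the transposition pairs equal monomials of opposite sign. Even and odd
  terms are matched directly, since \<open>s = - s\<close> would not give 0 in characteristic
  2.\<close>

lemma standard_polynomial_repeated:
  assumes "a \<noteq> b" "a < D" "b < D" "x a = x b"
  shows "standard_polynomial D x = 0"
proof -
  let ?p = "\<lambda>\<sigma>. prod_list (map (x \<circ> \<sigma>) [0..<D])"
  let ?S = "{\<sigma>. \<sigma> permutes {..<D}}"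
  let ?E = "{\<sigma> \<in> ?S. evenperm \<sigma>}" and ?O = "{\<sigma> \<in> ?S. \<not> evenperm \<sigma>}"
  let ?\<tau> = "transpose a b"
  have \<tau>: "?\<tau> permutes {..<D}" using assms by (intro permutes_swap_id) auto
  have parity: "evenperm (?\<tau> \<circ> \<sigma>) \<longleftrightarrow> \<not> evenperm \<sigma>" if "\<sigma> permutes {..<D}" for \<sigma>
    using evenperm_comp[OF permutes_imp_permutation[OF _ \<tau>] permutes_imp_permutation[OF _ that]] assms(1)
    by (simp add: evenperm_swap)
  have x\<tau>: "x \<circ> ?\<tau> = x" using assms(4) by (auto simp: transpose_def)
  have invol: "?\<tau> \<circ> (?\<tau> \<circ> \<sigma>) = \<sigma>" for \<sigma> :: "nat \<Rightarrow> nat"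
    by (simp add: fun_eq_iff)
  have "sum ?p ?O = sum ?p ?E"
  proof (rule sum.reindex_bij_witness[where i = "(\<circ>) ?\<tau>" and j = "(\<circ>) ?\<tau>"])
    show "?p (?\<tau> \<circ> \<sigma>) = ?p \<sigma>" for \<sigma>
      by (simp only: o_assoc x\<tau>)
  qed (auto simp: parity invol intro: permutes_compose[OF _ \<tau>])
  moreover have "standard_polynomial D x = sum ?p ?E - sum ?p ?O"
  proof -
    have fin: "finite ?S" by (simp add: finite_permutations)
    have S: "?S = ?E \<union> ?O" "?E \<inter> ?O = {}" by auto
    have "standard_polynomial D x = (\<Sum>\<sigma>\<in>?E. of_int (sign \<sigma>) * ?p \<sigma>) + (\<Sum>\<sigma>\<in>?O. of_int (sign \<sigma>) * ?p \<sigma>)"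
      unfolding standard_polynomial_def
      by (subst S(1), rule sum.union_disjoint) (use fin S(2) in auto)
    then show ?thesis by (simp add: sign_def sum_negf)
  qed
  ultimately show ?thesis by simp
qed

text \<open>Slot \<open>j\<close> occurs once in each monomial. \<open>P\<close> collects the
  arguments to its left, so it commutes with whatever commutes with all arguments.\<close>

lemma prod_list_permuted_slot:
  fixes x :: "nat \<Rightarrow> 'r::ring_1"
  assumes \<sigma>: "\<sigma> permutes {..<D}" and j: "j < D"
  obtains P Q where "\<And>y. prod_list (map (x(j := y) \<circ> \<sigma>) [0..<D]) = P * y * Q"
    "\<And>c. (\<And>i. i < D \<Longrightarrow> c * x i = x i * c) \<Longrightarrow> c * P = P * c"
proof -
  obtain k where k: "k < D" "\<sigma> k = j"
    using permutes_image[OF \<sigma>] j by (metis imageE lessThan_iff)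
  have ne: "\<sigma> i \<noteq> j" if "i \<noteq> k" for i
    using permutes_inj[OF \<sigma>] k(2) that by (auto dest: injD)
  have split: "[0..<D] = [0..<k] @ k # [Suc k..<D]"
    using upt_add_eq_append[of 0 k "D - k"] k(1) by (simp add: upt_conv_Cons)
  show ?thesis
  proof
    fix y
    have eqs: "map (x(j := y) \<circ> \<sigma>) [0..<k] = map (x \<circ> \<sigma>) [0..<k]"
      "map (x(j := y) \<circ> \<sigma>) [Suc k..<D] = map (x \<circ> \<sigma>) [Suc k..<D]"
      using ne by auto
    then show "prod_list (map (x(j := y) \<circ> \<sigma>) [0..<D]) =
        prod_list (map (x \<circ> \<sigma>) [0..<k]) * y * prod_list (map (x \<circ> \<sigma>) [Suc k..<D])"
      unfolding split map_append prod_list.append list.map prod_list.Cons eqs by (simp add: k(2) mult.assoc)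
  next
    fix c assume c: "\<And>i. i < D \<Longrightarrow> c * x i = x i * c"
    have "c * prod_list (map (x \<circ> \<sigma>) is) = prod_list (map (x \<circ> \<sigma>) is) * c" if "set is \<subseteq> {..<D}" for "is"
      using that
    proof (induction "is")
      case (Cons i "is")
      then have "\<sigma> i < D" using permutes_in_image[OF \<sigma>, of i] by simp
      with Cons show ?case by (simp add: c mult.assoc[symmetric]) (simp add: c mult.assoc)
    qed simp
    from this[of "[0..<k]"] show "c * prod_list (map (x \<circ> \<sigma>) [0..<k]) = prod_list (map (x \<circ> \<sigma>) [0..<k]) * c"
      using k(1) by (simp add: subset_iff)
  qed
qed

text \<open>Multilinearity: a coefficient in slot \<open>j\<close> has to pass the factors on its
  left, hence \<open>comm\<close>.\<close>

lemma standard_polynomial_slot_sum: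
  fixes x y c :: "nat \<Rightarrow> 'r::ring_1"
  assumes j: "j < D" and comm: "\<And>i k. i < D \<Longrightarrow> k < D \<Longrightarrow> c i * x k = x k * c i"
  shows "standard_polynomial D (x(j := \<Sum>i<D. c i * y i)) = (\<Sum>i<D. c i * standard_polynomial D (x(j := y i)))"
proof -
  let ?p = "\<lambda>\<sigma> z. prod_list (map (x(j := z) \<circ> \<sigma>) [0..<D])"
  have summand: "of_int (sign \<sigma>) * ?p \<sigma> (\<Sum>i<D. c i * y i) = (\<Sum>i<D. c i * (of_int (sign \<sigma>) * ?p \<sigma> (y i)))"
    if \<sigma>: "\<sigma> permutes {..<D}" for \<sigma>
  proof -
    obtain P Q where PQ: "\<And>z. ?p \<sigma> z = P * z * Q"
      and P: "\<And>d. (\<And>i. i < D \<Longrightarrow> d * x i = x i * d) \<Longrightarrow> d * P = P * d"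
      using prod_list_permuted_slot[OF \<sigma> j, of x] by metis
    have "c i * P = P * c i" if "i < D" for i using P comm that by blast
    then have "P * (c i * z) = c i * (P * z)" if "i < D" for i z
      using that by (metis mult.assoc)
    then have "P * (\<Sum>i<D. c i * y i) * Q = (\<Sum>i<D. c i * (P * y i * Q))"
      by (simp add: sum_distrib_left sum_distrib_right mult.assoc)
    then show ?thesis
      unfolding PQ by (simp add: sum_distrib_left mult_of_int_left_commute)
  qed
  show ?thesis
    unfolding standard_polynomial_def sum_distrib_left
    by (subst sum.swap) (intro sum.cong refl, simp add: summand)
qed

text \<open>With the relation put into slot \<open>j\<close>, all terms but the one for
  \<open>j\<close> have a repeated argument. What remains is \<open>c j\<close> times the
  polynomial, and \<open>d\<close> cancels \<open>c j\<close>.\<close>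

lemma standard_polynomial_dependent:
  fixes x c :: "nat \<Rightarrow> 'r::ring_1"
  assumes comm: "\<And>i k. i < D \<Longrightarrow> k < D \<Longrightarrow> c i * x k = x k * c i"
    and dep: "(\<Sum>i<D. c i * x i) = 0" and j: "j < D" and d: "d * c j = 1"
  shows "standard_polynomial D x = 0"
proof -
  have "standard_polynomial D (x(j := 0)) = 0"
    using standard_polynomial_slot_sum[OF j, where c = "\<lambda>_. 0" and x = x and y = "\<lambda>_. 0"] by simp
  then have "0 = (\<Sum>i<D. c i * standard_polynomial D (x(j := x i)))"
    using standard_polynomial_slot_sum[where c = c and x = x and y = x, OF j comm] by (simp add: dep)
  also have "\<dots> = c j * standard_polynomial D (x(j := x j))"
  proof (rule sum.remove[THEN trans])
    have "standard_polynomial D (x(j := x i)) = 0" if "i \<in> {..<D} - {j}" for i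
      using that j by (intro standard_polynomial_repeated[of i j]) auto
    then show "c j * standard_polynomial D (x(j := x j)) +
        (\<Sum>i\<in>{..<D} - {j}. c i * standard_polynomial D (x(j := x i))) = c j * standard_polynomial D (x(j := x j))"
      by simp
  qed (use j in auto)
  finally have "d * (c j * standard_polynomial D x) = 0" by simp
  then show ?thesis by (simp add: mult.assoc[symmetric] d)
qed

section \<open>Linear systems over a division subring\<close>

lemma division_subringD:
  assumes "division_subring K"
  shows "0 \<in> K" "1 \<in> K" "\<And>x y. x \<in> K \<Longrightarrow> y \<in> K \<Longrightarrow> x - y \<in> K"
    "\<And>x y. x \<in> K \<Longrightarrow> y \<in> K \<Longrightarrow> x * y \<in> K" "\<And>x. x \<in> K \<Longrightarrow> inverse x \<in> K"
  using assms unfolding division_subring_def by (metis diff_self, blast+)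

lemma division_subring_sum:
  assumes "division_subring K" "\<And>i. i \<in> I \<Longrightarrow> f i \<in> K"
  shows "sum f I \<in> K"
  using assms(2)
proof (induction I rule: infinite_finite_induct)
  case (insert i I)
  have "f i \<in> K" "sum f I \<in> K" using insert by auto
  then have "f i - (0 - sum f I) \<in> K" by (intro division_subringD[OF assms(1)])
  with insert.hyps show ?case by simp
qed (simp_all add: division_subringD(1)[OF assms(1)])

text \<open>Gaussian elimination of equation \<open>e\<close> with pivot \<open>p\<close>. The
  unknowns stand on the left, which forces the order of the factors in \<open>b\<close>. Every
  operation stays inside \<open>F\<close>, later the centre of \<open>K\<close>.\<close>

lemma underdetermined_system:
  fixes a :: "'e \<Rightarrow> 'i \<Rightarrow> 'a::division_ring"
  assumes F: "division_subring F"
    and "finite E" "finite I" "card E < card I" "\<And>e i. e \<in> E \<Longrightarrow> i \<in> I \<Longrightarrow> a e i \<in> F"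
  shows "\<exists>f. (\<forall>i\<in>I. f i \<in> F) \<and> (\<exists>i\<in>I. f i \<noteq> 0) \<and> (\<forall>e\<in>E. (\<Sum>i\<in>I. f i * a e i) = 0)"
  using assms(2-5)
proof (induction E arbitrary: I a rule: finite_induct)
  case empty
  then obtain i where "i \<in> I" by (metis card.empty card_gt_0_iff ex_in_conv)
  then show ?case using F by (intro exI[of _ "\<lambda>_. 1"]) (auto simp: division_subring_def)
next
  case (insert e E)
  note Fm = division_subringD(3-5)[OF F] and F0 = division_subringD(1)[OF F] and Fs = division_subring_sum[OF F]
  show ?case
  proof (cases "\<forall>i\<in>I. a e i = 0")
    case True
    have "\<exists>f. (\<forall>i\<in>I. f i \<in> F) \<and> (\<exists>i\<in>I. f i \<noteq> 0) \<and> (\<forall>e\<in>E. (\<Sum>i\<in>I. f i * a e i) = 0)"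
      using insert.prems insert.hyps by (intro insert.IH) auto
    then show ?thesis using True by auto
  next
    case False
    then obtain p where p: "p \<in> I" "a e p \<noteq> 0" by blast
    define b where "b e' i = a e' i - a e i * inverse (a e p) * a e' p" for e' i
    have "\<exists>f. (\<forall>i\<in>I - {p}. f i \<in> F) \<and> (\<exists>i\<in>I - {p}. f i \<noteq> 0) \<and> (\<forall>e'\<in>E. (\<Sum>i\<in>I - {p}. f i * b e' i) = 0)"
      using insert.prems insert.hyps p(1) by (intro insert.IH) (auto simp: b_def card_Diff_singleton intro!: Fm)
    then obtain f where f: "\<And>i. i \<in> I - {p} \<Longrightarrow> f i \<in> F" "\<exists>i\<in>I - {p}. f i \<noteq> 0"
      "\<And>e'. e' \<in> E \<Longrightarrow> (\<Sum>i\<in>I - {p}. f i * b e' i) = 0" by blast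
    define s where "s = (\<Sum>i\<in>I - {p}. f i * a e i)"
    \<comment> \<open>Equation \<open>e\<close> forces this value at the pivot unknown.\<close>
    define h where "h = f(p := - (s * inverse (a e p)))"
    have hsum: "(\<Sum>i\<in>I. h i * a e' i) = (\<Sum>i\<in>I - {p}. f i * a e' i) - s * inverse (a e p) * a e' p" for e'
      using p(1) insert.prems(1) by (simp add: sum.remove h_def)
    show ?thesis
    proof (intro exI[of _ h] conjI ballI)
      fix i assume "i \<in> I"
      have "s \<in> F" unfolding s_def using f(1) insert.prems(3) by (intro Fs Fm(2)) auto
      then have "0 - s * inverse (a e p) \<in> F"
        using p(1) by (intro Fm F0 insert.prems(3)) auto
      with \<open>i \<in> I\<close> f(1) show "h i \<in> F" by (simp add: h_def)
    next
      show "\<exists>i\<in>I. h i \<noteq> 0" using f(2) by (auto simp: h_def)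
    next
      fix e' assume "e' \<in> insert e E"
      then consider "e' = e" | "e' \<in> E" by blast
      then show "(\<Sum>i\<in>I. h i * a e' i) = 0"
      proof cases
        case 1
        then show ?thesis using p(2) by (simp add: hsum mult.assoc flip: s_def)
      next
        case 2
        then show ?thesis
          using f(3)[OF 2] unfolding hsum s_def b_def
          by (simp add: right_diff_distrib sum_subtractf sum_distrib_right mult.assoc)
      qed
    qed
  qed
qed

section \<open>Matrices as additive endomorphisms\<close>

text \<open>A type cannot depend on the size \<open>n\<close>, and maps on infinite sequences serve
  every size. Additivity alone admits both matrices and left multiplication by scalars.\<close>

typedef (overloaded) 'a endo =
  "{f :: (nat \<Rightarrow> 'a::ring_1) \<Rightarrow> nat \<Rightarrow> 'a. \<forall>u v. f (\<lambda>i. u i + v i) = (\<lambda>i. f u i + f v i)}"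
  morphisms endo_apply Endo
  by (rule exI[of _ id]) simp

setup_lifting type_definition_endo

instantiation endo :: (ring_1) ring_1
begin

lift_definition zero_endo :: "'a endo" is "\<lambda>u i. 0" by simp
lift_definition one_endo :: "'a endo" is "\<lambda>u. u" by simp
lift_definition plus_endo :: "'a endo \<Rightarrow> 'a endo \<Rightarrow> 'a endo" is "\<lambda>f g u i. f u i + g u i"
  by (simp add: add_ac)
lift_definition uminus_endo :: "'a endo \<Rightarrow> 'a endo" is "\<lambda>f u i. - f u i" by simp
lift_definition minus_endo :: "'a endo \<Rightarrow> 'a endo \<Rightarrow> 'a endo" is "\<lambda>f g u i. f u i - g u i"
  by (simp add: algebra_simps)
lift_definition times_endo :: "'a endo \<Rightarrow> 'a endo \<Rightarrow> 'a endo" is "\<lambda>f g u. f (g u)" by simp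

instance
proof
  show "(0 :: 'a endo) \<noteq> 1" by transfer (auto simp: fun_eq_iff intro!: exI[of _ "\<lambda>_. 1"])
qed (transfer, simp add: add_ac)+

end

lemma endo_apply_sum: "endo_apply (\<Sum>i\<in>I. h i) u k = (\<Sum>i\<in>I. endo_apply (h i) u k)"
  by (induction I rule: infinite_finite_induct) (simp_all add: plus_endo.rep_eq zero_endo.rep_eq)

lemma endo_apply_of_nat: "endo_apply (of_nat m) u i = of_nat m * u i"
  by (induction m) (simp_all add: plus_endo.rep_eq zero_endo.rep_eq one_endo.rep_eq distrib_right)

lemma endo_apply_of_int: "endo_apply (of_int m) u i = of_int m * u i"
  by (cases m rule: int_diff_cases) (simp add: endo_apply_of_nat minus_endo.rep_eq left_diff_distrib)

lemma endo_eqI: "(\<And>u i. endo_apply f u i = endo_apply g u i) \<Longrightarrow> f = g"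
  by (metis endo_apply_inject ext)

text \<open>Integers act pointwise by multiplication in the division ring, where each is either 0 or
  invertible.\<close>

lemma endo_characteristic:
  "(\<exists>m>0. (of_int m :: 'a::division_ring endo) = 0) \<or>
   (\<forall>(n::int) x::'a endo. of_int n * x = 0 \<longrightarrow> n = 0 \<or> x = 0)"
proof (cases "\<exists>m>0. (of_int m :: 'a) = 0")
  case True
  then obtain m :: int where "m > 0" "(of_int m :: 'a) = 0" by auto
  then show ?thesis
    by (intro disjI1 exI[of _ m]) (auto intro!: endo_eqI simp: endo_apply_of_int zero_endo.rep_eq)
next
  case False
  have nz: "(of_int n :: 'a) \<noteq> 0" if "n \<noteq> 0" for n
    using False that by (metis linorder_neqE_linordered_idom neg_0_less_iff_less neg_equal_0_iff_equal of_int_minus)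
  have tf: "x = 0" if "of_int n * x = 0" "n \<noteq> 0" for n and x :: "'a endo"
  proof (rule endo_eqI)
    fix u i
    have "endo_apply (of_int n * x) u i = 0" by (simp add: that(1) zero_endo.rep_eq)
    then show "endo_apply x u i = endo_apply 0 u i"
      using nz[OF that(2)] by (simp add: times_endo.rep_eq endo_apply_of_int zero_endo.rep_eq)
  qed
  show ?thesis
  proof (rule disjI2, intro allI impI)
    show "n = 0 \<or> x = 0" if "of_int n * x = 0" for n and x :: "'a endo"
      using tf[OF that] by (cases "n = 0") simp_all
  qed
qed

lift_definition scalar_endo :: "'a::ring_1 \<Rightarrow> 'a endo" is "\<lambda>c u i. c * u i"
  by (simp add: distrib_left)

text \<open>A matrix acts block-diagonally, so that the identity matrix acts as the identity.\<close>

lift_definition mat_endo :: "nat \<Rightarrow> 'a::ring_1 mat \<Rightarrow> 'a endo" is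
  "\<lambda>n M u i. \<Sum>j<n. M $$ (i mod n, j) * u (n * (i div n) + j)"
  by (simp add: distrib_left sum.distrib)

lemma mat_endo_one: "n > 0 \<Longrightarrow> mat_endo n (1\<^sub>m n) = 1"
proof (rule endo_eqI)
  fix u :: "nat \<Rightarrow> 'a" and i assume n: "n > 0"
  have "(\<Sum>j<n. 1\<^sub>m n $$ (i mod n, j) * u (n * (i div n) + j)) =
      (\<Sum>j<n. if j = i mod n then u i else 0)"
    using n by (intro sum.cong refl) auto
  then show "endo_apply (mat_endo n (1\<^sub>m n)) u i = endo_apply 1 u i"
    using n by (simp add: mat_endo.rep_eq one_endo.rep_eq)
qed

lemma mat_endo_mult:
  assumes "n > 0" "A \<in> carrier_mat n n" "B \<in> carrier_mat n n"
  shows "mat_endo n (A * B) = mat_endo n A * mat_endo n B"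
proof (rule endo_eqI)
  fix u :: "nat \<Rightarrow> 'a" and i
  let ?u = "\<lambda>j. u (n * (i div n) + j)"
  have i: "i mod n < n" using assms(1) by simp
  have "endo_apply (mat_endo n (A * B)) u i = (\<Sum>j<n. \<Sum>k<n. A $$ (i mod n, k) * B $$ (k, j) * ?u j)"
    unfolding mat_endo.rep_eq
  proof (intro sum.cong refl)
    fix j assume "j \<in> {..<n}"
    then show "(A * B) $$ (i mod n, j) * ?u j = (\<Sum>k<n. A $$ (i mod n, k) * B $$ (k, j) * ?u j)"
      using assms i by (simp add: scalar_prod_def sum_distrib_right atLeast0LessThan)
  qed
  also have "\<dots> = (\<Sum>k<n. A $$ (i mod n, k) * (\<Sum>j<n. B $$ (k, j) * ?u j))"
    by (subst sum.swap) (simp add: sum_distrib_left mult.assoc)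
  also have "\<dots> = endo_apply (mat_endo n A * mat_endo n B) u i"
    by (simp add: mat_endo.rep_eq times_endo.rep_eq)
  finally show "endo_apply (mat_endo n (A * B)) u i = endo_apply (mat_endo n A * mat_endo n B) u i" .
qed

lemma inj_on_mat_endo: "inj_on (mat_endo n) (carrier_mat n n :: 'a::ring_1 mat set)"
proof
  fix A B :: "'a mat"
  assume AB: "A \<in> carrier_mat n n" "B \<in> carrier_mat n n" "mat_endo n A = mat_endo n B"
  have entry: "endo_apply (mat_endo n M) (\<lambda>k. if k = j then 1 else 0) i = M $$ (i, j)"
    if "i < n" "j < n" for i j and M :: "'a mat"
    using that by (simp add: mat_endo.rep_eq if_distrib cong: if_cong)
  show "A = B"
    by (rule eq_matI) (use AB entry[of _ _ A] entry[of _ _ B] in auto)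
qed

lemma scalar_endo_commute:
  assumes "n > 0" and c: "\<And>i j. i < n \<Longrightarrow> j < n \<Longrightarrow> c * M $$ (i, j) = M $$ (i, j) * c"
  shows "scalar_endo c * mat_endo n M = mat_endo n M * scalar_endo c"
proof (rule endo_eqI)
  fix u :: "nat \<Rightarrow> 'a" and i
  have "c * (M $$ (i mod n, j) * y) = M $$ (i mod n, j) * (c * y)" if "j < n" for j y
    using c[of "i mod n" j] that assms(1) by (simp flip: mult.assoc)
  then show "endo_apply (scalar_endo c * mat_endo n M) u i = endo_apply (mat_endo n M * scalar_endo c) u i"
    by (simp add: times_endo.rep_eq scalar_endo.rep_eq mat_endo.rep_eq sum_distrib_left)
qed

section \<open>Coordinates over the centre and the identity for matrices\<close>

lemma division_subring_ring_center:
  assumes "division_subring K"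
  shows "division_subring (ring_center K)"
  unfolding division_subring_def
proof (intro conjI ballI)
  note centerD = ring_center_def[of K, THEN eq_refl, THEN subsetD, simplified]
  have centerI: "z \<in> ring_center K" if "z \<in> K" "\<And>x. x \<in> K \<Longrightarrow> z * x = x * z" for z
    using that unfolding ring_center_def by blast
  show "1 \<in> ring_center K" using assms by (intro centerI) (auto simp: division_subring_def)
  fix x assume x: "x \<in> ring_center K"
  have xK: "x \<in> K" and xc: "\<And>z. z \<in> K \<Longrightarrow> x * z = z * x" using centerD[OF x] by blast+
  show "inverse x \<in> ring_center K"
  proof (rule centerI)
    show "inverse x \<in> K" using assms xK by (simp add: division_subring_def)
    show "inverse x * z = z * inverse x" if "z \<in> K" for z
      by (rule mult_commute_imp_mult_inverse_commute[OF xc[OF that]])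
  qed
  fix y assume y: "y \<in> ring_center K"
  have yK: "y \<in> K" and yc: "\<And>z. z \<in> K \<Longrightarrow> y * z = z * y" using centerD[OF y] by blast+
  show "x - y \<in> ring_center K"
    using assms xK yK by (intro centerI) (simp_all add: division_subring_def left_diff_distrib right_diff_distrib xc yc)
  show "x * y \<in> ring_center K"
  proof (rule centerI)
    show "x * y \<in> K" using assms xK yK by (simp add: division_subring_def)
    show "x * y * z = z * (x * y)" if "z \<in> K" for z
      using xc[OF that] yc[OF that] by (metis mult.assoc)
  qed
qed

lemma centrally_finite_coordinates:
  fixes K :: "'a::division_ring set"
  assumes K: "division_subring K" "centrally_finite K"
  obtains us :: "'a list" where
    "\<And>x. x \<in> K \<Longrightarrow> \<exists>c. (\<forall>l<length us. c l \<in> ring_center K) \<and> x = (\<Sum>l<length us. c l * us ! l)"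
proof -
  let ?R = "ring_of_type_algebra :: 'a ring"
  interpret ring ?R by (rule ring_ring_of_type_algebra)
  note F = subfield_ring_center[OF K(1)]
  obtain us where us: "Span (ring_center K) us = K"
    using exists_base[OF F finite_dimensionE[OF F]] K(2) unfolding centrally_finite_def by blast
  have ops: "\<zero>\<^bsub>?R\<^esub> = 0" "x \<otimes>\<^bsub>?R\<^esub> y = x * y" "x \<oplus>\<^bsub>?R\<^esub> y = x + y" for x y
    by (simp_all add: ring_of_type_algebra_def)
  have combine: "combine ks vs = (\<Sum>l<length vs. ks ! l * vs ! l)" if "length ks = length vs" for ks vs
    using that
  proof (induction ks vs rule: list_induct2)
    case (Cons k ks v vs)
    then show ?case by (simp add: ops sum.lessThan_Suc_shift del: sum.lessThan_Suc)
  qed (simp add: ops)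
  show ?thesis
  proof (rule that[of us])
    fix x assume "x \<in> K"
    moreover have "set us \<subseteq> carrier ?R" by (simp add: ring_of_type_algebra_def)
    ultimately obtain ks where "length ks = length us" "set ks \<subseteq> ring_center K" "x = combine ks us"
      using Span_eq_combine_set_length_version[OF F, of us] us by blast
    then show "\<exists>c. (\<forall>l<length us. c l \<in> ring_center K) \<and> x = (\<Sum>l<length us. c l * us ! l)"
      by (intro exI[of _ "(!) ks"]) (auto simp: combine)
  qed
qed

text \<open>Matrices over \<open>K\<close> form a finite-dimensional algebra over the centre of \<open>K\<close>, and an alternating
  form in more variables than its dimension vanishes.\<close>

lemma matrices_standard_identity:
  fixes K :: "'a::division_ring set"
  assumes K: "division_subring K" "centrally_finite K" and n: "n > 0"
  obtains D where "\<And>Y. (\<And>i r s. i < D \<Longrightarrow> r < n \<Longrightarrow> s < n \<Longrightarrow> Y i $$ (r, s) \<in> K) \<Longrightarrow>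
    standard_polynomial D (\<lambda>i. mat_endo n (Y i)) = 0"
proof -
  let ?F = "ring_center K"
  obtain us :: "'a list" where us:
    "\<And>x. x \<in> K \<Longrightarrow> \<exists>c. (\<forall>l<length us. c l \<in> ?F) \<and> x = (\<Sum>l<length us. c l * us ! l)"
    using centrally_finite_coordinates[OF K] by blast
  then have "\<forall>x\<in>K. \<exists>c. (\<forall>l<length us. c l \<in> ?F) \<and> x = (\<Sum>l<length us. c l * us ! l)" by blast
  from bchoice[OF this] obtain co where co: "\<And>x l. x \<in> K \<Longrightarrow> l < length us \<Longrightarrow> co x l \<in> ?F"
    "\<And>x. x \<in> K \<Longrightarrow> x = (\<Sum>l<length us. co x l * us ! l)" by blast
  let ?E = "{..<n} \<times> {..<n} \<times> {..<length us}"
  \<comment> \<open>One unknown more than equations: there is an equation for each matrix position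
    and each coordinate over the centre.\<close>
  define D where "D = Suc (card ?E)"
  have "standard_polynomial D (\<lambda>i. mat_endo n (Y i)) = 0"
    if Y: "\<And>i r s. i < D \<Longrightarrow> r < n \<Longrightarrow> s < n \<Longrightarrow> Y i $$ (r, s) \<in> K" for Y
  proof -
    let ?a = "\<lambda>(r, s, l) i. co (Y i $$ (r, s)) l"
    have "\<exists>f. (\<forall>i\<in>{..<D}. f i \<in> ?F) \<and> (\<exists>i\<in>{..<D}. f i \<noteq> 0) \<and> (\<forall>e\<in>?E. (\<Sum>i<D. f i * ?a e i) = 0)"
      by (rule underdetermined_system[OF division_subring_ring_center[OF K(1)]])
        (auto simp: D_def[symmetric] co(1) Y, simp add: D_def)
    then obtain f where f: "\<And>i. i < D \<Longrightarrow> f i \<in> ?F" and "\<exists>i\<in>{..<D}. f i \<noteq> 0"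
      and f_eq: "\<forall>e\<in>?E. (\<Sum>i<D. f i * ?a e i) = 0"
      by blast
    then obtain j where j: "j < D" "f j \<noteq> 0" by blast
    have eq: "(\<Sum>i<D. f i * co (Y i $$ (r, s)) l) = 0" if "r < n" "s < n" "l < length us" for r s l
      using bspec[OF f_eq, of "(r, s, l)"] that by simp
    have entries: "(\<Sum>i<D. f i * Y i $$ (r, s)) = 0" if "r < n" "s < n" for r s
    proof -
      have "(\<Sum>i<D. f i * Y i $$ (r, s)) = (\<Sum>i<D. \<Sum>l<length us. f i * co (Y i $$ (r, s)) l * us ! l)"
      proof (intro sum.cong refl)
        fix i assume "i \<in> {..<D}"
        then have "Y i $$ (r, s) = (\<Sum>l<length us. co (Y i $$ (r, s)) l * us ! l)"
          using co(2) Y that by blast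
        then show "f i * Y i $$ (r, s) = (\<Sum>l<length us. f i * co (Y i $$ (r, s)) l * us ! l)"
          by (metis (no_types, lifting) mult.assoc sum.cong sum_distrib_left)
      qed
      also have "\<dots> = (\<Sum>l<length us. (\<Sum>i<D. f i * co (Y i $$ (r, s)) l) * us ! l)"
        by (subst sum.swap) (simp add: sum_distrib_right)
      also have "\<dots> = 0" using eq that by simp
      finally show ?thesis .
    qed
    show ?thesis
    \<comment> \<open>The \<open>f i\<close> are central in \<open>K\<close> and hence commute with
      all entries, so the scalar maps commute with the matrices.\<close>
    proof (rule standard_polynomial_dependent[where c = "\<lambda>i. scalar_endo (f i)"])
      fix i k assume "i < D" "k < D"
      then show "scalar_endo (f i) * mat_endo n (Y k) = mat_endo n (Y k) * scalar_endo (f i)"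
        using f[of i] Y[of k] n by (intro scalar_endo_commute) (auto simp: ring_center_def)
    next
      show "(\<Sum>i<D. scalar_endo (f i) * mat_endo n (Y i)) = 0"
      proof (rule endo_eqI)
        fix u :: "nat \<Rightarrow> 'a" and k
        have "endo_apply (\<Sum>i<D. scalar_endo (f i) * mat_endo n (Y i)) u k =
            (\<Sum>s<n. (\<Sum>i<D. f i * Y i $$ (k mod n, s)) * u (n * (k div n) + s))"
          unfolding endo_apply_sum times_endo.rep_eq scalar_endo.rep_eq mat_endo.rep_eq
            sum_distrib_left sum_distrib_right
          by (subst sum.swap) (simp add: mult.assoc)
        also have "\<dots> = 0" using entries n by simp
        finally show "endo_apply (\<Sum>i<D. scalar_endo (f i) * mat_endo n (Y i)) u k = endo_apply 0 u k"
          by (simp add: zero_endo.rep_eq)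
      qed
    next
      show "scalar_endo (inverse (f j)) * scalar_endo (f j) = 1"
        by (rule endo_eqI)
          (simp add: times_endo.rep_eq scalar_endo.rep_eq one_endo.rep_eq j(2) flip: mult.assoc)
    qed (rule j(1))
  qed
  then show ?thesis using that by blast
qed

section \<open>The generated subgroup as a set of words\<close>

theorem corollary6p12:
  fixes n :: nat and H :: "'a::division_ring mat set"
  assumes "weakly_locally_finite TYPE('a)"
    and "n > 0"
    and "subgroup H (GL n TYPE('a))"
    and "periodic_group ((GL n TYPE('a))\<lparr>carrier := H\<rparr>)"
  shows "locally_finite_group ((GL n TYPE('a))\<lparr>carrier := H\<rparr>)"
  unfolding locally_finite_group_def
proof (intro allI impI)
  let ?G = "GL n TYPE('a)" and ?H = "(GL n TYPE('a))\<lparr>carrier := H\<rparr>"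
  fix S assume S: "S \<subseteq> carrier ?H" "finite S"
  note G_simps = GL_def units_of_mult units_of_one units_of_carrier ring_mat_simps
  interpret G: group ?G by (rule group_GL)
  interpret H: group ?H by (rule G.subgroup_imp_group[OF assms(3)])
  have Hmat: "H \<subseteq> carrier_mat n n"
    using subgroup.subset[OF assms(3)] by (auto simp: G_simps Units_def)
  have mat_endo_1: "mat_endo n (1\<^sub>m n :: 'a mat) = 1" by (rule mat_endo_one[OF assms(2)])
  have one_H: "1\<^sub>m n \<in> H" and mult_H: "\<And>A B. A \<in> H \<Longrightarrow> B \<in> H \<Longrightarrow> A * B \<in> H"
    using subgroup.one_closed[OF assms(3)] subgroup.m_closed[OF assms(3)] by (simp_all add: G_simps)
  \<comment> \<open>With the inverses as letters, plain products reach the whole generated subgroup,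
    and the entries of the inverses are in \<open>K\<close> by construction.\<close>
  define T where "T = S \<union> (\<lambda>M. inv\<^bsub>?H\<^esub> M) ` S"
  have T: "finite T" "T \<subseteq> H" using S H.inv_closed by (auto simp: T_def)
  define K where "K = division_subring_generated {M $$ (i, j) | M i j. M \<in> T \<and> i < n \<and> j < n}"
  have "{M $$ (i, j) | M i j. M \<in> T \<and> i < n \<and> j < n} = (\<lambda>(M, i, j). M $$ (i, j)) ` (T \<times> {..<n} \<times> {..<n})"
    by force
  then have finT: "finite {M $$ (i, j) | M i j. M \<in> T \<and> i < n \<and> j < n}" using T(1) by simp
  have K: "division_subring K" unfolding K_def by (rule division_subring_generated)
  have cK: "centrally_finite K"
    using assms(1) finT unfolding weakly_locally_finite_def K_def by blast
  have TK: "M $$ (i, j) \<in> K" if "M \<in> T" "i < n" "j < n" for M i j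
    using division_subring_generated(2)[of "{M $$ (i, j) | M i j. M \<in> T \<and> i < n \<and> j < n}"] that
    unfolding K_def by blast
  note K_mult = division_subringD(4)[OF K] and K_0 = division_subringD(1)[OF K]
    and K_1 = division_subringD(2)[OF K] and K_sum = division_subring_sum[OF K]
  \<comment> \<open>List indices serve as letters because words are compared over a well-ordered
    alphabet.\<close>
  obtain ts where ts: "set ts = T" using finite_list[OF T(1)] by blast
  define g where "g i = mat_endo n (ts ! i)" for i
  let ?A = "{..<length ts}"
  let ?ev = "\<lambda>w. prod_list (map g w)"
  have word_mat: "\<exists>M\<in>H. (\<forall>i<n. \<forall>j<n. M $$ (i, j) \<in> K) \<and> ?ev w = mat_endo n M" if "w \<in> lists ?A" for w
    using that
  proof (induction w)
    case Nil
    then show ?case using one_H mat_endo_1 K_0 K_1 by (intro bexI[of _ "1\<^sub>m n"]) auto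
  next
    case (Cons t w)
    then obtain M where M: "M \<in> H" "\<And>i j. i < n \<Longrightarrow> j < n \<Longrightarrow> M $$ (i, j) \<in> K" "?ev w = mat_endo n M"
      by auto
    let ?t = "ts ! t"
    have t: "?t \<in> T" using Cons.hyps ts by auto
    have mats: "?t \<in> carrier_mat n n" "M \<in> carrier_mat n n" using t T(2) M(1) Hmat by auto
    have "(?t * M) $$ (i, j) \<in> K" if "i < n" "j < n" for i j
    proof -
      have "(?t * M) $$ (i, j) = (\<Sum>k\<in>{0..<n}. ?t $$ (i, k) * M $$ (k, j))"
        using mats that by (simp add: scalar_prod_def)
      also have "\<dots> \<in> K" using TK[OF t] M(2) that by (intro K_sum K_mult) auto
      finally show ?thesis .
    qed
    moreover have "?t * M \<in> H" using mult_H t T(2) M(1) by blast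
    moreover have "?ev (t # w) = mat_endo n (?t * M)"
      using M(3) mat_endo_mult[OF assms(2) mats] by (simp add: g_def[of t])
    ultimately show ?case by blast
  qed
  have "finite (?ev ` lists ?A)"
  proof -
    obtain D where D: "\<And>Y. (\<And>i r s. i < D \<Longrightarrow> r < n \<Longrightarrow> s < n \<Longrightarrow> Y i $$ (r, s) \<in> K) \<Longrightarrow>
        standard_polynomial D (\<lambda>i. mat_endo n (Y i)) = 0"
      using matrices_standard_identity[OF K cK assms(2)] by metis
    show ?thesis
    proof (rule finite_periodic_words[where D = D])
      fix w assume "w \<in> lists ?A"
      then obtain M where M: "M \<in> H" "?ev w = mat_endo n M" using word_mat by blast
      have pow: "M [^]\<^bsub>?H\<^esub> k \<in> H \<and> mat_endo n (M [^]\<^bsub>?H\<^esub> k) = mat_endo n M ^ k" for k :: nat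
      proof (induction k)
        case 0
        then show ?case using one_H mat_endo_1 by (simp add: G_simps)
      next
        case (Suc k)
        then show ?case
          using M(1) mult_H Hmat mat_endo_mult[OF assms(2), of "M [^]\<^bsub>?H\<^esub> k" M]
          by (auto simp: G_simps power_commutes subset_iff)
      qed
      obtain k :: nat where "k > 0" "M [^]\<^bsub>?H\<^esub> k = \<one>\<^bsub>?H\<^esub>"
        using assms(4) M(1) unfolding periodic_group_def by auto
      then show "\<exists>k>0. ?ev w ^ k = 1"
        using pow[of k] M(2) mat_endo_1 by (intro exI[of _ k]) (simp add: G_simps)
    next
      fix x assume "\<And>i. i < D \<Longrightarrow> x i \<in> lists ?A"
      then have "\<forall>i. \<exists>M. i < D \<longrightarrow> (\<forall>r<n. \<forall>s<n. M $$ (r, s) \<in> K) \<and> ?ev (x i) = mat_endo n M"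
        using word_mat by blast
      then obtain Y where Y: "\<And>i r s. i < D \<Longrightarrow> r < n \<Longrightarrow> s < n \<Longrightarrow> Y i $$ (r, s) \<in> K"
        "\<And>i. i < D \<Longrightarrow> ?ev (x i) = mat_endo n (Y i)" by metis
      have "standard_polynomial D (\<lambda>i. ?ev (x i)) = standard_polynomial D (\<lambda>i. mat_endo n (Y i))"
        unfolding standard_polynomial_def
      proof (intro sum.cong refl arg_cong2[where f = "(*)"] arg_cong[where f = prod_list] map_cong)
        fix \<sigma> i assume "\<sigma> \<in> {\<sigma>. \<sigma> permutes {..<D}}" "i \<in> set [0..<D]"
        then have "\<sigma> i < D" using permutes_in_image[of \<sigma> "{..<D}" i] by simp
        then show "((\<lambda>i. ?ev (x i)) \<circ> \<sigma>) i = ((\<lambda>i. mat_endo n (Y i)) \<circ> \<sigma>) i" by (simp add: Y(2))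
      qed
      with D[OF Y(1)] show "standard_polynomial D (\<lambda>i. ?ev (x i)) = 0" by simp
    qed (rule finite_lessThan endo_characteristic)+
  qed
  moreover have gen: "M \<in> H \<and> mat_endo n M \<in> ?ev ` lists ?A" if "M \<in> generate ?H S" for M
    using that
  proof (induction M rule: generate.induct)
    case one
    have "mat_endo n (1\<^sub>m n) \<in> ?ev ` lists ?A"
      by (rule image_eqI[of _ _ "[]"]) (simp_all add: mat_endo_1)
    then show ?case using one_H by (simp add: G_simps)
  next
    case (eng A B)
    then obtain v w where vw: "v \<in> lists ?A" "mat_endo n A = ?ev v" "w \<in> lists ?A" "mat_endo n B = ?ev w"
      by auto
    have "mat_endo n (A * B) = ?ev (v @ w)"
      using mat_endo_mult[OF assms(2), of A B] eng.IH Hmat vw by auto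
    moreover have "v @ w \<in> lists ?A" using vw by auto
    ultimately have "mat_endo n (A * B) \<in> ?ev ` lists ?A" by (rule image_eqI)
    then show ?case using eng.IH mult_H by (simp add: G_simps)
  next
    case (incl M)
    have "M \<in> T" using incl by (simp add: T_def)
    then obtain i where "i < length ts" "ts ! i = M" using ts by (metis in_set_conv_nth)
    then have "mat_endo n M = ?ev [i]" "[i] \<in> lists ?A" by (simp_all add: g_def)
    then show ?case using \<open>M \<in> T\<close> T(2) by (auto intro: image_eqI[of _ _ "[i]"])
  next
    case (inv M)
    have "inv\<^bsub>?H\<^esub> M \<in> T" using inv by (simp add: T_def)
    then obtain i where "i < length ts" "ts ! i = inv\<^bsub>?H\<^esub> M" using ts by (metis in_set_conv_nth)
    then have "mat_endo n (inv\<^bsub>?H\<^esub> M) = ?ev [i]" "[i] \<in> lists ?A" by (simp_all add: g_def)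
    then show ?case using \<open>inv\<^bsub>?H\<^esub> M \<in> T\<close> T(2) by (auto intro: image_eqI[of _ _ "[i]"])
  qed
  ultimately have "finite (mat_endo n ` generate ?H S)"
    by (meson finite_subset image_subsetI)
  moreover have "inj_on (mat_endo n) (generate ?H S)"
    using gen Hmat by (intro inj_on_subset[OF inj_on_mat_endo]) blast
  ultimately show "finite (generate ?H S)" by (rule finite_imageD)
qed

end
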